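(* Let $f\in\mathcal P$ be an admissible entire function, and let $\xi$ be the least positive solution of $f'(x)=0$. Suppose that for every $\theta$ with $-\pi<\theta\le\pi$ we have either (1) $\sup_{t>0}|f(te^{i\theta})|>f(\xi)$, or (2) $|f(te^{i\theta})|<f(\xi)$ for all $0<t<\xi$. Let $A$ be any bounded linear operator on a complex Banach space satisfying $\sup_{t>0}\|f(tA)\|\le f(\xi)$. Then $r(A)=\|A\|$. In particular, if $A$ is quasi-nilpotent then $A=0$. Furthermore, if $\sup_{t>0}\|f(tA)\|<f(\xi)$, then $A=0$.
   Context: All Banach spaces are complex. $r(A)$ is the spectral radius of $A$; quasi-nilpotent means $r(A)=0$; $f(tA)$ is given by the holomorphic functional calculus. Class $\mathcal P$ (for entire functions): an entire function $f$ belongs to $\mathcal P$ if (i) $f(0)=0$; (ii) $f'(0)\ne 0$; (iii) $f(x)\in\mathbb R$ for all real $x$; (iv) the local inverse function $\varphi=f^{-1}$ of $f$ at the origin, defined and analytic in a neighborhood of $0$ with $\varphi(0)=0$, satisfies $\varphi^{(n)}(0)\ge 0$ for all $n\ge1$. An entire $f\in\mathcal P$ is admissible if there exists a real $x>0$ with $f'(x)=0$. *)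

theory Defs
  imports "HOL-Complex_Analysis.Complex_Analysis"
begin

section \<open>Complex Banach spaces\<close>

class complex_normed_vector = real_normed_vector +
  fixes scaleC :: "complex \<Rightarrow> 'a \<Rightarrow> 'a"  (infixr \<open>*\<^sub>C\<close> 75)
  assumes scaleC_of_real: "complex_of_real r *\<^sub>C x = r *\<^sub>R x"
    and scaleC_add_right: "c *\<^sub>C (x + y) = c *\<^sub>C x + c *\<^sub>C y"
    and scaleC_add_left: "(c + d) *\<^sub>C x = c *\<^sub>C x + d *\<^sub>C x"
    and scaleC_scaleC: "c *\<^sub>C (d *\<^sub>C x) = (c * d) *\<^sub>C x"
    and norm_scaleC: "norm (c *\<^sub>C x) = cmod c * norm x"

class complex_banach = complex_normed_vector + banach

instantiation complex :: complex_banach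
begin

definition scaleC_complex :: "complex \<Rightarrow> complex \<Rightarrow> complex" where
  "scaleC_complex c x = c * x"

instance
  by standard (auto simp: scaleC_complex_def scaleR_conv_of_real algebra_simps norm_mult)

end

lemma bounded_linear_scaleC: "bounded_linear (\<lambda>x::'a::complex_normed_vector. c *\<^sub>C x)"
proof
  show "c *\<^sub>C (x + y) = c *\<^sub>C x + c *\<^sub>C y" for x y :: 'a
    by (rule scaleC_add_right)
  show "c *\<^sub>C (r *\<^sub>R x) = r *\<^sub>R (c *\<^sub>C x)" for r and x :: 'a
    by (simp add: scaleC_of_real [symmetric] scaleC_scaleC mult.commute)
  show "\<exists>K. \<forall>x::'a. norm (c *\<^sub>C x) \<le> norm x * K"
    by (rule exI [of _ "cmod c"]) (simp add: norm_scaleC)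
qed

instantiation blinfun :: (real_normed_vector, complex_normed_vector) complex_normed_vector
begin

lift_definition scaleC_blinfun :: "complex \<Rightarrow> ('a \<Rightarrow>\<^sub>L 'b) \<Rightarrow> ('a \<Rightarrow>\<^sub>L 'b)"
  is "\<lambda>c A x. c *\<^sub>C A x"
  by (rule bounded_linear_compose [OF bounded_linear_scaleC])

instance
proof
  fix r :: real and c d :: complex and A B :: "'a \<Rightarrow>\<^sub>L 'b"
  show "complex_of_real r *\<^sub>C A = r *\<^sub>R A"
    by transfer (simp add: scaleC_of_real)
  show "c *\<^sub>C (A + B) = c *\<^sub>C A + c *\<^sub>C B"
    by transfer (simp add: scaleC_add_right)
  show "(c + d) *\<^sub>C A = c *\<^sub>C A + d *\<^sub>C A"
    by transfer (simp add: scaleC_add_left)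
  show "c *\<^sub>C (d *\<^sub>C A) = (c * d) *\<^sub>C A"
    by transfer (simp add: scaleC_scaleC)
  show "norm (c *\<^sub>C A) = cmod c * norm A"
  proof transfer
    fix c :: complex and A :: "'a \<Rightarrow> 'b"
    assume "bounded_linear A"
    then have "onorm (\<lambda>x. cmod c *\<^sub>R A x) = cmod c * onorm A"
      by (simp add: onorm_scaleR)
    then show "onorm (\<lambda>x. c *\<^sub>C A x) = cmod c * onorm A"
      by (simp add: onorm_def norm_scaleC)
  qed
qed

end

instance blinfun :: (real_normed_vector, complex_banach) complex_banach ..

section \<open>Spectrum and holomorphic functional calculus\<close>

text \<open>The type of bounded linear maps from the library only records real linearity, so complex
  linearity is a separate predicate. The operator norm is the same in both readings.\<close>

definition complex_linear :: "('a::complex_normed_vector \<Rightarrow>\<^sub>L 'b::complex_normed_vector) \<Rightarrow> bool" where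
  "complex_linear A \<longleftrightarrow> (\<forall>c x. blinfun_apply A (c *\<^sub>C x) = c *\<^sub>C blinfun_apply A x)"

definition is_resolvent_at ::
    "('a::complex_normed_vector \<Rightarrow>\<^sub>L 'a) \<Rightarrow> complex \<Rightarrow> ('a \<Rightarrow>\<^sub>L 'a) \<Rightarrow> bool" where
  "is_resolvent_at A z B \<longleftrightarrow> complex_linear B \<and>
     B o\<^sub>L (z *\<^sub>C id_blinfun - A) = id_blinfun \<and> (z *\<^sub>C id_blinfun - A) o\<^sub>L B = id_blinfun"

definition spectrum :: "('a::complex_normed_vector \<Rightarrow>\<^sub>L 'a) \<Rightarrow> complex set" where
  "spectrum A = {z. \<not> (\<exists>B. is_resolvent_at A z B)}"

definition resolvent :: "('a::complex_normed_vector \<Rightarrow>\<^sub>L 'a) \<Rightarrow> complex \<Rightarrow> ('a \<Rightarrow>\<^sub>L 'a)" where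
  "resolvent A z = (THE B. is_resolvent_at A z B)"

text \<open>Inserting \<open>0\<close> matters only on the zero space, where the spectrum is empty and the
  spectral radius is \<open>0\<close> by convention.\<close>

definition spectral_radius :: "('a::complex_normed_vector \<Rightarrow>\<^sub>L 'a) \<Rightarrow> real" where
  "spectral_radius A = (SUP z\<in>insert 0 (spectrum A). cmod z)"

definition quasi_nilpotent :: "('a::complex_normed_vector \<Rightarrow>\<^sub>L 'a) \<Rightarrow> bool" where
  "quasi_nilpotent A \<longleftrightarrow> spectral_radius A = 0"

text \<open>The Riesz--Dunford integral \<open>1/(2 \<pi> i) \<integral> f(z) (z - A)\<inverse> dz\<close> for entire \<open>f\<close>. The library's
  contour integral is complex-valued, so the integral over the parametrised path is written out.
  The circle of radius \<open>\<parallel>A\<parallel> + 1\<close> surrounds the spectrum; the value does not depend on the contour.\<close>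

definition holomorphic_calculus ::
    "(complex \<Rightarrow> complex) \<Rightarrow> ('a::complex_banach \<Rightarrow>\<^sub>L 'a) \<Rightarrow> ('a \<Rightarrow>\<^sub>L 'a)" where
  "holomorphic_calculus f A =
     (let \<gamma> = circlepath 0 (norm A + 1) in
       (1 / (2 * of_real pi * \<i>)) *\<^sub>C
         integral {0..1}
           (\<lambda>s. (f (\<gamma> s) * vector_derivative \<gamma> (at s within {0..1})) *\<^sub>C resolvent A (\<gamma> s)))"

section \<open>The class P\<close>

definition local_inverse_at_0 :: "(complex \<Rightarrow> complex) \<Rightarrow> (complex \<Rightarrow> complex) \<Rightarrow> bool" where
  "local_inverse_at_0 f \<phi> \<longleftrightarrow> \<phi> analytic_on {0} \<and> \<phi> 0 = 0 \<and>
     (\<forall>\<^sub>F w in nhds 0. f (\<phi> w) = w) \<and> (\<forall>\<^sub>F z in nhds 0. \<phi> (f z) = z)"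

text \<open>The local inverse exists and is unique as a germ because \<open>f 0 = 0\<close> and \<open>f' 0 \<noteq> 0\<close>,
  so the existential quantifier in the last clause just names it.\<close>

definition class_P :: "(complex \<Rightarrow> complex) \<Rightarrow> bool" where
  "class_P f \<longleftrightarrow> f holomorphic_on UNIV \<and> f 0 = 0 \<and> deriv f 0 \<noteq> 0 \<and>
     (\<forall>x::real. f (of_real x) \<in> \<real>) \<and>
     (\<exists>\<phi>. local_inverse_at_0 f \<phi> \<and> (\<forall>n\<ge>1. (deriv ^^ n) \<phi> 0 \<in> \<real>\<^sub>\<ge>\<^sub>0))"

definition admissible :: "(complex \<Rightarrow> complex) \<Rightarrow> bool" where
  "admissible f \<longleftrightarrow> (\<exists>x::real. x > 0 \<and> deriv f (of_real x) = 0)"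

end

theory Submission
  imports Defs
begin

text \<open>Let \<open>\<phi> = \<Sum> c\<^sub>n w\<^sup>n\<close> be the inverse germ of \<open>f\<close>, so \<open>c\<^sub>n \<ge> 0\<close>, and put \<open>m = f \<xi>\<close>. The idea is to recover
\<open>t A\<close> from \<open>f(t A)\<close> as \<open>\<phi>(f(t A))\<close>: since the coefficients are non-negative, this gives
\<open>t \<parallel>A\<parallel> \<le> \<phi>(\<parallel>f(t A)\<parallel>) \<le> \<phi>(m) \<le> \<xi>\<close>. If the identity holds for all \<open>t\<close> with \<open>t r(A) < \<xi>\<close>, then letting
\<open>t r(A)\<close> tend to \<open>\<xi>\<close> (or \<open>t\<close> to infinity, when \<open>r(A) = 0\<close>) yields \<open>\<parallel>A\<parallel> \<le> r(A)\<close>. If the supremum of the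
norms is some \<open>N < m\<close>, the same argument gives \<open>\<parallel>A\<parallel> \<le> r(A) \<phi>(N) / \<xi>\<close> with \<open>\<phi>(N) < \<xi>\<close>, so \<open>A = 0\<close>.

The series must therefore converge absolutely at \<open>m\<close>. On the real axis \<open>f\<close> increases on \<open>[0, \<xi>]\<close>
and has a holomorphic inverse near every value below \<open>m\<close>; by the Vivanti--Pringsheim theorem
(\<open>vivanti_pringsheim\<close>) a series with non-negative coefficients cannot have its radius of convergence
at such a point. Hence the radius is at least \<open>m\<close>, and \<open>\<phi>(f x) = x\<close> for \<open>x < \<xi>\<close> bounds the partial
sums at \<open>m\<close> by \<open>\<xi>\<close>.

The identity \<open>\<phi>(f(t A)) = t A\<close> is proved by connectedness in \<open>t\<close> (\<open>fps_inverse_along_ray\<close>). Write \<open>X = \<phi>(f(t A))\<close>. Then \<open>f(X) = f(t A)\<close>, and \<open>X\<close>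
commutes with \<open>A\<close>, so \<open>(X - t A) H = 0\<close>, where \<open>H\<close> is the divided difference of \<open>f\<close> at \<open>X\<close> and
\<open>t A\<close>. Where \<open>X = t A\<close>, the element \<open>H\<close> is \<open>f'(t A)\<close>; if that is invertible, \<open>H\<close> stays invertible for
nearby parameters and \<open>X = t A\<close> persists. So the set of good \<open>t\<close> is open and closed.

Finally \<open>f'(t A)\<close> is invertible as soon as \<open>f'(t \<lambda>) \<noteq> 0\<close> on the spectrum
(\<open>invertible_fps_apply_entire\<close>). For \<open>\<lambda> \<noteq> 0\<close> in the spectrum \<open>|f(t \<lambda>)| \<le> \<parallel>f(t A)\<parallel> \<le> m\<close> for all \<open>t > 0\<close>, which
excludes the first alternative for the direction of \<open>\<lambda>\<close>. The second one says that \<open>|f| < m\<close> along the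
ray up to modulus \<open>\<xi>\<close>, where \<open>\<phi>(f z) = z\<close> by analytic continuation and so \<open>f' \<noteq> 0\<close>.\<close>

section \<open>Power series in a complex Banach algebra\<close>

class complex_banach_algebra_1 = complex_banach + real_normed_algebra_1 +
  assumes scaleC_mult_left: "(c *\<^sub>C x) * y = c *\<^sub>C (x * y)"
    and scaleC_mult_right: "x * (c *\<^sub>C y) = c *\<^sub>C (x * y)"

lemma scaleC_one_left [simp]: "1 *\<^sub>C x = x"
  using scaleC_of_real[of 1 x] by simp

lemma scaleC_zero_left [simp]: "0 *\<^sub>C x = 0"
  using scaleC_of_real[of 0 x] by simp

lemma bounded_bilinear_scaleC: "bounded_bilinear ((*\<^sub>C) :: complex \<Rightarrow> 'a::complex_normed_vector \<Rightarrow> 'a)"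
proof
  fix c d :: complex and x y :: 'a and r :: real
  show "(c + d) *\<^sub>C x = c *\<^sub>C x + d *\<^sub>C x" by (rule scaleC_add_left)
  show "c *\<^sub>C (x + y) = c *\<^sub>C x + c *\<^sub>C y" by (rule scaleC_add_right)
  show "(r *\<^sub>R c) *\<^sub>C x = r *\<^sub>R (c *\<^sub>C x)"
    by (simp add: scaleR_conv_of_real scaleC_scaleC[symmetric] scaleC_of_real)
  show "c *\<^sub>C (r *\<^sub>R x) = r *\<^sub>R (c *\<^sub>C x)"
    by (rule linear_scale) (simp add: bounded_linear.linear bounded_linear_scaleC)
  show "\<exists>K. \<forall>(c::complex) x::'a. norm (c *\<^sub>C x) \<le> norm c * norm x * K"
    by (rule exI[of _ 1]) (simp add: norm_scaleC)
qed

lemmas scaleC_diff_left = bounded_bilinear.diff_left[OF bounded_bilinear_scaleC]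
lemmas scaleC_zero_right [simp] = bounded_bilinear.zero_right[OF bounded_bilinear_scaleC]
lemmas scaleC_sum_left = bounded_bilinear.sum_left[OF bounded_bilinear_scaleC]
lemmas tendsto_scaleC = bounded_bilinear.tendsto[OF bounded_bilinear_scaleC]
lemmas continuous_on_scaleC [continuous_intros] =
  bounded_bilinear.continuous_on[OF bounded_bilinear_scaleC]

lemma scaleC_power: "(c *\<^sub>C x) ^ n = c ^ n *\<^sub>C (x ^ n :: 'a::complex_banach_algebra_1)"
  by (induction n) (simp_all add: scaleC_mult_left scaleC_mult_right scaleC_scaleC mult.commute)

subsection \<open>Weighted absolute convergence\<close>

text \<open>Under the weighted norm of the next definition, power series that converge absolutely at \<open>\<rho>\<close> form a
Banach algebra. It controls evaluation at all elements of norm at most \<open>\<rho>\<close>. The closed condition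
matters: the inverse germ is applied to operators whose norm may equal its radius of convergence.\<close>

definition abs_conv :: "complex fps \<Rightarrow> real \<Rightarrow> bool" where
  "abs_conv F \<rho> \<longleftrightarrow> summable (\<lambda>n. cmod (fps_nth F n) * \<rho> ^ n)"

definition weighted_norm :: "complex fps \<Rightarrow> real \<Rightarrow> real" where
  "weighted_norm F \<rho> = (\<Sum>n. cmod (fps_nth F n) * \<rho> ^ n)"

lemma abs_conv_in_radius:
  assumes "0 \<le> \<rho>" "ereal \<rho> < fps_conv_radius F"
  shows "abs_conv F \<rho>"
  using norm_summable_fps[of "of_real \<rho>" F] assms by (simp add: abs_conv_def norm_mult norm_power)

lemma abs_conv_mono: "abs_conv F \<rho> \<Longrightarrow> 0 \<le> \<rho>' \<Longrightarrow> \<rho>' \<le> \<rho> \<Longrightarrow> abs_conv F \<rho>'"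
  unfolding abs_conv_def
  by (rule summable_comparison_test'[where N = 0]) (auto intro!: mult_left_mono power_mono)

lemma weighted_norm_nonneg: "abs_conv F \<rho> \<Longrightarrow> 0 \<le> \<rho> \<Longrightarrow> 0 \<le> weighted_norm F \<rho>"
  unfolding weighted_norm_def abs_conv_def by (rule suminf_nonneg) auto

lemma weighted_norm_mono:
  assumes "abs_conv F \<rho>" "0 \<le> \<rho>'" "\<rho>' \<le> \<rho>"
  shows "weighted_norm F \<rho>' \<le> weighted_norm F \<rho>"
  unfolding weighted_norm_def
  using assms abs_conv_mono[OF assms]
  by (intro suminf_le) (auto simp: abs_conv_def intro!: mult_left_mono power_mono)

lemma abs_conv_mult:
  assumes F: "abs_conv F \<rho>" and G: "abs_conv G \<rho>" and "0 \<le> \<rho>"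
  shows "abs_conv (F * G) \<rho>"
    and "weighted_norm (F * G) \<rho> \<le> weighted_norm F \<rho> * weighted_norm G \<rho>"
proof -
  let ?a = "\<lambda>n. cmod (fps_nth F n) * \<rho> ^ n" and ?b = "\<lambda>n. cmod (fps_nth G n) * \<rho> ^ n"
  let ?c = "\<lambda>n. \<Sum>i\<le>n. ?a i * ?b (n - i)"
  have c: "?c sums (weighted_norm F \<rho> * weighted_norm G \<rho>)"
    unfolding weighted_norm_def
    by (rule Cauchy_product_sums) (use assms in \<open>auto simp: abs_conv_def norm_mult\<close>)
  have le: "cmod (fps_nth (F * G) n) * \<rho> ^ n \<le> ?c n" for n
  proof -
    have "cmod (fps_nth (F * G) n) * \<rho> ^ n
        \<le> (\<Sum>i\<le>n. cmod (fps_nth F i * fps_nth G (n - i))) * \<rho> ^ n"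
      unfolding fps_mult_nth atLeast0AtMost using \<open>0 \<le> \<rho>\<close> by (intro mult_right_mono norm_sum) auto
    also have "\<dots> = ?c n"
      unfolding sum_distrib_right
      by (intro sum.cong refl) (simp add: norm_mult mult_ac power_add[symmetric])
    finally show ?thesis .
  qed
  show FG: "abs_conv (F * G) \<rho>"
    unfolding abs_conv_def
  proof (rule summable_comparison_test'[OF sums_summable[OF c], of 0])
    fix n
    have "norm (cmod (fps_nth (F * G) n) * \<rho> ^ n) = cmod (fps_nth (F * G) n) * \<rho> ^ n"
      using \<open>0 \<le> \<rho>\<close> by simp
    then show "norm (cmod (fps_nth (F * G) n) * \<rho> ^ n) \<le> ?c n" using le[of n] by (simp only:)
  qed
  show "weighted_norm (F * G) \<rho> \<le> weighted_norm F \<rho> * weighted_norm G \<rho>"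
    unfolding weighted_norm_def[of "F * G"] sums_unique[OF c]
    by (rule suminf_le[OF le FG[unfolded abs_conv_def] sums_summable[OF c]])
qed

lemma abs_conv_const [simp]: "abs_conv (fps_const c) \<rho>"
  unfolding abs_conv_def by (rule summable_finite[of "{0}"]) auto

lemma abs_conv_1 [simp]: "abs_conv 1 \<rho>"
  using abs_conv_const[of 1] by simp

lemma weighted_norm_1 [simp]: "weighted_norm 1 \<rho> = 1"
  unfolding weighted_norm_def by (subst suminf_finite[of "{0}"]) auto

lemma abs_conv_power:
  assumes "abs_conv F \<rho>" "0 \<le> \<rho>"
  shows "abs_conv (F ^ k) \<rho> \<and> weighted_norm (F ^ k) \<rho> \<le> weighted_norm F \<rho> ^ k"
proof (induction k)
  case (Suc k)
  then have "weighted_norm (F * F ^ k) \<rho> \<le> weighted_norm F \<rho> * weighted_norm (F ^ k) \<rho>"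
    using assms abs_conv_mult by blast
  also have "\<dots> \<le> weighted_norm F \<rho> * weighted_norm F \<rho> ^ k"
    using Suc weighted_norm_nonneg[OF assms] by (intro mult_left_mono) auto
  finally show ?case using Suc assms abs_conv_mult(1)[of F \<rho> "F ^ k"] by simp
qed simp

lemma abs_conv_add:
  assumes "abs_conv F \<rho>" "abs_conv G \<rho>" "0 \<le> \<rho>"
  shows "abs_conv (F + G) \<rho>"
  unfolding abs_conv_def
proof (rule summable_comparison_test'[where N = 0])
  show "summable (\<lambda>n. cmod (fps_nth F n) * \<rho> ^ n + cmod (fps_nth G n) * \<rho> ^ n)"
    using assms by (intro summable_add) (auto simp: abs_conv_def)
  fix n show "norm (cmod (fps_nth (F + G) n) * \<rho> ^ n) \<le> cmod (fps_nth F n) * \<rho> ^ n + cmod (fps_nth G n) * \<rho> ^ n"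
    using \<open>0 \<le> \<rho>\<close> norm_triangle_ineq[of "fps_nth F n" "fps_nth G n"]
    by (simp add: abs_mult distrib_right[symmetric] mult_right_mono)
qed

lemma abs_conv_cmult: "abs_conv F \<rho> \<Longrightarrow> 0 \<le> \<rho> \<Longrightarrow> abs_conv (fps_const c * F) \<rho>"
  by (rule abs_conv_mult) simp_all

lemma abs_conv_uminus [simp]: "abs_conv (- F) \<rho> = abs_conv F \<rho>"
  by (simp add: abs_conv_def)

lemma abs_conv_diff: "abs_conv F \<rho> \<Longrightarrow> abs_conv G \<rho> \<Longrightarrow> 0 \<le> \<rho> \<Longrightarrow> abs_conv (F - G) \<rho>"
  using abs_conv_add[of F \<rho> "- G"] by simp

lemma abs_conv_X [simp]: "abs_conv fps_X \<rho>"
  unfolding abs_conv_def by (rule summable_finite[of "{1}"]) (auto simp: fps_X_def)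

subsection \<open>Evaluation\<close>

definition fps_apply :: "complex fps \<Rightarrow> 'a::complex_banach_algebra_1 \<Rightarrow> 'a" where
  "fps_apply F a = (\<Sum>n. fps_nth F n *\<^sub>C a ^ n)"

lemma summable_norm_fps_apply:
  assumes "abs_conv F (norm a)"
  shows "summable (\<lambda>n. norm (fps_nth F n *\<^sub>C (a :: 'a::complex_banach_algebra_1) ^ n))"
  using assms unfolding abs_conv_def
  by (rule summable_comparison_test'[where N = 0])
     (simp add: norm_scaleC mult_left_mono norm_power_ineq)

lemma fps_apply_sums: "abs_conv F (norm a) \<Longrightarrow> (\<lambda>n. fps_nth F n *\<^sub>C a ^ n) sums fps_apply F a"
  unfolding fps_apply_def
  by (intro summable_sums summable_norm_cancel[OF summable_norm_fps_apply])

lemma fps_apply_eqI: "(\<lambda>n. fps_nth F n *\<^sub>C a ^ n) sums x \<Longrightarrow> fps_apply F a = x"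
  unfolding fps_apply_def by (simp add: sums_iff)

lemma norm_fps_apply_le:
  assumes "abs_conv F \<rho>" "norm a \<le> \<rho>"
  shows "norm (fps_apply F a) \<le> weighted_norm F \<rho>"
proof -
  have a: "abs_conv F (norm a)" using abs_conv_mono[OF assms(1) _ assms(2)] by simp
  have "norm (fps_apply F a) \<le> (\<Sum>n. norm (fps_nth F n *\<^sub>C a ^ n))"
    unfolding fps_apply_def by (rule summable_norm[OF summable_norm_fps_apply[OF a]])
  also have "\<dots> \<le> weighted_norm F (norm a)"
    unfolding weighted_norm_def
    using summable_norm_fps_apply[OF a] a
    by (intro suminf_le) (auto simp: norm_scaleC abs_conv_def mult_left_mono norm_power_ineq)
  also have "\<dots> \<le> weighted_norm F \<rho>" by (rule weighted_norm_mono[OF assms(1) _ assms(2)]) simp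
  finally show ?thesis .
qed

lemma fps_apply_mult:
  assumes "abs_conv F (norm a)" "abs_conv G (norm a)"
  shows "fps_apply (F * G) a = fps_apply F a * fps_apply G a"
proof (rule fps_apply_eqI)
  have "(\<lambda>n. \<Sum>i\<le>n. (fps_nth F i *\<^sub>C a ^ i) * (fps_nth G (n - i) *\<^sub>C a ^ (n - i)))
      sums (fps_apply F a * fps_apply G a)"
    unfolding fps_apply_def
    by (intro Cauchy_product_sums summable_norm_fps_apply assms)
  also have "(\<lambda>n. \<Sum>i\<le>n. (fps_nth F i *\<^sub>C a ^ i) * (fps_nth G (n - i) *\<^sub>C a ^ (n - i)))
      = (\<lambda>n. fps_nth (F * G) n *\<^sub>C a ^ n)"
    unfolding fps_mult_nth atLeast0AtMost scaleC_sum_left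
    by (intro ext sum.cong refl)
       (simp add: scaleC_mult_left scaleC_mult_right scaleC_scaleC power_add[symmetric] mult.commute)
  finally show "(\<lambda>n. fps_nth (F * G) n *\<^sub>C a ^ n) sums (fps_apply F a * fps_apply G a)" .
qed

lemma fps_apply_const: "fps_apply (fps_const c) a = c *\<^sub>C 1"
  unfolding fps_apply_def by (subst suminf_finite[of "{0}"]) auto

lemma fps_apply_1 [simp]: "fps_apply 1 a = 1"
  using fps_apply_const[of 1 a] by simp

lemma fps_apply_X [simp]: "fps_apply fps_X a = a"
  unfolding fps_apply_def by (subst suminf_finite[of "{1}"]) (auto simp: fps_X_def)

lemma fps_apply_zero: "fps_apply F 0 = fps_nth F 0 *\<^sub>C 1"
  unfolding fps_apply_def by (subst suminf_finite[of "{0}"]) (auto simp: zero_power)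

lemma fps_apply_add:
  "abs_conv F (norm a) \<Longrightarrow> abs_conv G (norm a) \<Longrightarrow> fps_apply (F + G) a = fps_apply F a + fps_apply G a"
  by (rule fps_apply_eqI) (simp add: scaleC_add_left sums_add fps_apply_sums)

lemma fps_apply_diff:
  "abs_conv F (norm a) \<Longrightarrow> abs_conv G (norm a) \<Longrightarrow> fps_apply (F - G) a = fps_apply F a - fps_apply G a"
  by (rule fps_apply_eqI) (simp add: scaleC_diff_left sums_diff fps_apply_sums)

lemma fps_apply_power:
  assumes "abs_conv F (norm a)"
  shows "fps_apply (F ^ k) a = fps_apply F a ^ k"
  using abs_conv_power[OF assms] assms by (induction k) (simp_all add: fps_apply_mult)

subsection \<open>Composition\<close>

text \<open>A polynomial in \<open>G\<close> may be evaluated before or after inserting \<open>a\<close>; the case of an infinite series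
is the limit of this one.\<close>

lemma abs_conv_sum_powers:
  assumes "abs_conv G \<rho>" "0 \<le> \<rho>" "norm a \<le> \<rho>"
  shows "abs_conv (\<Sum>k<K. fps_const (c k) * G ^ k) \<rho> \<and>
    fps_apply (\<Sum>k<K. fps_const (c k) * G ^ k) a = (\<Sum>k<K. c k *\<^sub>C fps_apply G a ^ k)"
proof (induction K)
  case 0
  show ?case using fps_apply_const[of 0 a] abs_conv_const[of 0] by simp
next
  case (Suc K)
  have m: "abs_conv H \<rho> \<Longrightarrow> abs_conv H (norm a)" for H
    using abs_conv_mono assms(3) by auto
  have p: "abs_conv (G ^ K) \<rho>" using abs_conv_power assms by blast
  have q: "abs_conv (fps_const (c K) * G ^ K) \<rho>" by (intro abs_conv_cmult p assms)
  show ?case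
    using Suc q abs_conv_add[OF _ q] m[OF q] m[OF p] m assms
    by (simp add: fps_apply_add fps_apply_mult fps_apply_const fps_apply_power scaleC_mult_left)
qed

text \<open>Substitution of series commutes with evaluation as soon as the outer series converges absolutely at
the weighted norm of the inner one, because that norm dominates all powers of the inner series
simultaneously.\<close>

theorem fps_apply_compose:
  assumes G: "abs_conv G \<rho>" and a: "norm a \<le> \<rho>" and G0: "fps_nth G 0 = 0"
    and F: "abs_conv F (weighted_norm G \<rho>)"
  shows "fps_apply F (fps_apply G a) = fps_apply (F oo G) a"
proof -
  define w where "w = weighted_norm G \<rho>"
  define H where "H = F oo G"
  \<comment> \<open>The partial sums of \<open>F\<close>, composed with \<open>G\<close>. They converge to the composition in the weighted
    norm, which avoids interchanging two infinite sums.\<close>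
  define P where "P = (\<lambda>K. \<Sum>k<K. fps_const (fps_nth F k) * G ^ k)"
  have \<rho>: "0 \<le> \<rho>" using a norm_ge_zero order_trans by blast
  have w: "0 \<le> w" unfolding w_def by (rule weighted_norm_nonneg[OF G \<rho>])
  have Gk: "abs_conv (G ^ k) \<rho>" "weighted_norm (G ^ k) \<rho> \<le> w ^ k" for k
    using abs_conv_power[OF G \<rho>] by (auto simp: w_def)
  have sF: "summable (\<lambda>k. cmod (fps_nth F k) * w ^ k)" using F by (simp add: abs_conv_def w_def)
  have lt: "fps_nth (G ^ k) n = 0" if "n < k" for n k
    using startsby_zero_power_prefix[OF G0] that by blast
  have P: "abs_conv (P K) \<rho>" "fps_apply (P K) a = (\<Sum>k<K. fps_nth F k *\<^sub>C fps_apply G a ^ k)" for K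
    using abs_conv_sum_powers[OF G \<rho> a, of "fps_nth F" K] by (auto simp: P_def)
  define tail where "tail = (\<lambda>K. \<Sum>k. cmod (fps_nth F (k + K)) * w ^ (k + K))"
  \<comment> \<open>As \<open>G\<close> has no constant term, the powers of \<open>G\<close> from \<open>n + 1\<close> on do not reach coefficient \<open>n\<close>, so
    the range of \<open>k\<close> may be cut off at any bound above \<open>n\<close>.\<close>
  have coeff: "fps_nth (H - P K) n = (\<Sum>k\<in>{K..<K+m}. fps_nth F k * fps_nth (G ^ k) n)"
    if "n < m" for n m K
  proof -
    have "fps_nth H n = (\<Sum>k\<in>{0..<K+m}. fps_nth F k * fps_nth (G ^ k) n)"
      unfolding H_def fps_compose_nth
      by (rule sum.mono_neutral_left) (use that lt in auto)
    also have "\<dots> = (\<Sum>k\<in>{0..<K}. fps_nth F k * fps_nth (G ^ k) n)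
        + (\<Sum>k\<in>{K..<K+m}. fps_nth F k * fps_nth (G ^ k) n)"
      by (rule sum.atLeastLessThan_concat[symmetric]) auto
    finally show ?thesis
      by (simp add: P_def fps_sum_nth atLeast0LessThan)
  qed
  have bound: "(\<Sum>n<m. cmod (fps_nth (H - P K) n) * \<rho> ^ n) \<le> tail K" for m K
  proof -
    have "(\<Sum>n<m. cmod (fps_nth (H - P K) n) * \<rho> ^ n)
        \<le> (\<Sum>n<m. (\<Sum>k\<in>{K..<K+m}. cmod (fps_nth F k) * cmod (fps_nth (G ^ k) n)) * \<rho> ^ n)"
    proof (intro sum_mono mult_right_mono)
      fix n assume "n \<in> {..<m}"
      then have "n < m" by simp
      then show "cmod (fps_nth (H - P K) n)
          \<le> (\<Sum>k\<in>{K..<K+m}. cmod (fps_nth F k) * cmod (fps_nth (G ^ k) n))"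
        unfolding coeff[OF \<open>n < m\<close>] by (intro sum_norm_le) (simp add: norm_mult)
    qed (use \<rho> in simp)
    also have "\<dots> = (\<Sum>k\<in>{K..<K+m}. cmod (fps_nth F k) * (\<Sum>n<m. cmod (fps_nth (G ^ k) n) * \<rho> ^ n))"
      unfolding sum_distrib_right sum_distrib_left
      by (subst sum.swap) (simp add: mult.assoc)
    also have "\<dots> \<le> (\<Sum>k\<in>{K..<K+m}. cmod (fps_nth F k) * w ^ k)"
    proof (intro sum_mono mult_left_mono)
      fix k
      have "(\<Sum>n<m. cmod (fps_nth (G ^ k) n) * \<rho> ^ n) \<le> weighted_norm (G ^ k) \<rho>"
        unfolding weighted_norm_def using Gk(1)[of k] \<rho>
        by (intro sum_le_suminf) (auto simp: abs_conv_def)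
      then show "(\<Sum>n<m. cmod (fps_nth (G ^ k) n) * \<rho> ^ n) \<le> w ^ k" using Gk(2)[of k] by simp
    qed simp
    also have "\<dots> = (\<Sum>k<m. cmod (fps_nth F (k + K)) * w ^ (k + K))"
      using sum.shift_bounds_nat_ivl[of "\<lambda>k. cmod (fps_nth F k) * w ^ k" 0 K m]
      by (simp add: atLeast0LessThan add.commute)
    also have "\<dots> \<le> tail K"
      unfolding tail_def
      by (intro sum_le_suminf summable_ignore_initial_segment[OF sF]) (use w in auto)
    finally show ?thesis .
  qed
  have HP: "abs_conv (H - P K) \<rho>" "weighted_norm (H - P K) \<rho> \<le> tail K" for K
  proof -
    show c: "abs_conv (H - P K) \<rho>"
      unfolding abs_conv_def using bound \<rho> by (intro summableI_nonneg_bounded[where x = "tail K"]) auto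
    show "weighted_norm (H - P K) \<rho> \<le> tail K"
      unfolding weighted_norm_def using bound c
      by (intro suminf_le_const) (auto simp: abs_conv_def)
  qed
  have "P 0 = 0" by (simp add: P_def)
  then have H: "abs_conv H \<rho>" using HP(1)[of 0] by simp
  have m: "abs_conv H \<rho> \<Longrightarrow> abs_conv H (norm a)" for H
    using abs_conv_mono a by auto
  have "norm (fps_apply (P K) a - fps_apply H a) \<le> tail K" for K
    using norm_fps_apply_le[OF HP(1) a] HP(2) fps_apply_diff[OF m[OF H] m[OF P(1)]]
    by (metis norm_minus_commute order_trans)
  moreover have "tail \<longlonglongrightarrow> 0"
    unfolding tail_def using suminf_exist_split2[OF sF] by simp
  ultimately have "(\<lambda>K. fps_apply (P K) a - fps_apply H a) \<longlonglongrightarrow> 0"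
    by (intro Lim_null_comparison[of "\<lambda>K. fps_apply (P K) a - fps_apply H a" tail]) simp_all
  then have "(\<lambda>K. fps_apply (P K) a) \<longlonglongrightarrow> fps_apply H a" by (simp add: LIM_zero_iff)
  then have "(\<lambda>k. fps_nth F k *\<^sub>C fps_apply G a ^ k) sums fps_apply H a"
    by (simp add: sums_def P(2))
  then show ?thesis unfolding H_def by (rule fps_apply_eqI)
qed

section \<open>Divided differences and invertibility\<close>

text \<open>The sum of \<open>x\<^sup>i y\<^sup>j\<close> over \<open>i + j = n\<close>, that is, the divided difference of the power with exponent \<open>n + 1\<close>.
The order of the factors is fixed because \<open>x\<close> and \<open>y\<close> need not commute.\<close>

primrec power_divdiff :: "nat \<Rightarrow> 'a::ring_1 \<Rightarrow> 'a \<Rightarrow> 'a" where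
  "power_divdiff 0 x y = 1"
| "power_divdiff (Suc n) x y = x ^ Suc n + power_divdiff n x y * y"

lemma power_divdiff_mult:
  assumes "x * y = y * x"
  shows "(x - y) * power_divdiff n x y = x ^ Suc n - y ^ Suc n"
    and "power_divdiff n x y * (x - y) = x ^ Suc n - y ^ Suc n"
proof -
  have c: "x ^ n * y = y * x ^ n" for n by (rule power_commuting_commutes[OF assms])
  show *: "(x - y) * power_divdiff n x y = x ^ Suc n - y ^ Suc n" for n
  proof (induction n)
    case (Suc n)
    have "(x - y) * power_divdiff (Suc n) x y
        = (x - y) * x ^ Suc n + ((x - y) * power_divdiff n x y) * y"
      by (simp add: distrib_left mult.assoc)
    also have "\<dots> = x * x ^ Suc n - y * x ^ Suc n + x ^ Suc n * y - y ^ Suc n * y"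
      unfolding Suc.IH by (simp only: left_diff_distrib diff_add_eq add_diff_eq)
    also have "\<dots> = x ^ Suc (Suc n) - y ^ Suc (Suc n)"
      using c[of "Suc n"] by (simp add: power_commutes mult.assoc)
    finally show ?case .
  qed simp
  have "power_divdiff n x y * y = y * power_divdiff n x y" for n
  proof (induction n)
    case (Suc n)
    show ?case by (simp only: power_divdiff.simps distrib_left distrib_right c Suc.IH mult.assoc)
  qed simp
  moreover have "power_divdiff n x y * x = x * power_divdiff n x y" for n
  proof (induction n)
    case (Suc n)
    have "power_divdiff n x y * y * x = x * (power_divdiff n x y * y)"
      by (metis Suc.IH assms mult.assoc)
    then show ?case by (simp add: distrib_left distrib_right power_commutes mult.assoc)
  qed simp
  ultimately show "power_divdiff n x y * (x - y) = x ^ Suc n - y ^ Suc n"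
    using *[of n] by (simp add: left_diff_distrib right_diff_distrib)
qed

lemma power_divdiff_same: "power_divdiff n x x = of_nat (Suc n) * x ^ n"
  by (induction n) (simp_all add: distrib_right mult.assoc power_commutes)

lemma norm_power_divdiff_le:
  fixes x y :: "'a::real_normed_algebra_1"
  assumes "norm x \<le> \<rho>" "norm y \<le> \<rho>"
  shows "norm (power_divdiff n x y) \<le> real (Suc n) * \<rho> ^ n"
proof (induction n)
  case (Suc n)
  have \<rho>: "0 \<le> \<rho>" using assms norm_ge_zero order_trans by blast
  have "norm (x ^ Suc n) \<le> \<rho> ^ Suc n"
    using norm_power_ineq[of x "Suc n"] power_mono[OF assms(1), of "Suc n"] by simp
  moreover have "norm (power_divdiff n x y * y) \<le> (real (Suc n) * \<rho> ^ n) * \<rho>"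
    using norm_mult_ineq[of "power_divdiff n x y" y] mult_mono[OF Suc assms(2)] \<rho>
    by (smt (verit) mult_nonneg_nonneg norm_ge_zero of_nat_0_le_iff zero_le_power)
  ultimately have "norm (power_divdiff (Suc n) x y) \<le> \<rho> ^ Suc n + (real (Suc n) * \<rho> ^ n) * \<rho>"
    using norm_triangle_ineq[of "x ^ Suc n" "power_divdiff n x y * y"] by simp
  then show ?case by (simp add: algebra_simps)
qed simp

definition divided_difference ::
    "complex fps \<Rightarrow> 'a::complex_banach_algebra_1 \<Rightarrow> 'a \<Rightarrow> 'a" where
  "divided_difference F x y = (\<Sum>n. fps_nth F (Suc n) *\<^sub>C power_divdiff n x y)"

context
  fixes F :: "complex fps"
  assumes entire: "fps_conv_radius F = \<infinity>"
begin

lemma abs_conv_entire: "0 \<le> \<rho> \<Longrightarrow> abs_conv F \<rho>"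
  by (rule abs_conv_in_radius) (simp_all add: entire)

lemma summable_divdiff_bound:
  assumes "0 \<le> \<rho>"
  shows "summable (\<lambda>n. cmod (fps_nth F (Suc n)) * (real (Suc n) * \<rho> ^ n))"
proof -
  have "abs_conv (fps_deriv F) \<rho>"
    by (rule abs_conv_in_radius[OF assms]) (use fps_conv_radius_deriv[of F] entire in auto)
  then have "summable (\<lambda>n. cmod (fps_nth F (Suc n)) * (cmod (of_nat (Suc n)) * \<rho> ^ n))"
    by (simp add: abs_conv_def norm_mult mult_ac del: of_nat_Suc)
  then show ?thesis by (simp only: norm_of_nat)
qed

lemma norm_divdiff_term_le:
  fixes x y :: "'a::complex_banach_algebra_1"
  assumes "norm x \<le> \<rho>" "norm y \<le> \<rho>"
  shows "norm (fps_nth F (Suc n) *\<^sub>C power_divdiff n x y)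
    \<le> cmod (fps_nth F (Suc n)) * (real (Suc n) * \<rho> ^ n)"
  unfolding norm_scaleC by (intro mult_left_mono norm_power_divdiff_le assms) simp

lemma divided_difference_sums:
  "(\<lambda>n. fps_nth F (Suc n) *\<^sub>C power_divdiff n x y) sums divided_difference F x y"
  unfolding divided_difference_def
  by (rule summable_sums, rule summable_comparison_test'[where N = 0,
        OF summable_divdiff_bound[of "max (norm x) (norm y)"]])
     (use norm_divdiff_term_le[of x "max (norm x) (norm y)" y] in \<open>auto simp: le_max_iff_disj\<close>)

text \<open>The reason for introducing divided differences: equal values of \<open>F\<close> at commuting elements force them
to coincide once the divided difference is invertible. Both orders are needed to get two-sided
inverses.\<close>

lemma divided_difference_mult:
  assumes "x * y = y * x"
  shows "(x - y) * divided_difference F x y = fps_apply F x - fps_apply F y"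
    and "divided_difference F x y * (x - y) = fps_apply F x - fps_apply F y"
proof -
  have "(\<lambda>n. fps_nth F n *\<^sub>C x ^ n - fps_nth F n *\<^sub>C y ^ n) sums (fps_apply F x - fps_apply F y)"
    by (intro sums_diff fps_apply_sums abs_conv_entire) simp_all
  then have s: "(\<lambda>n. fps_nth F (Suc n) *\<^sub>C (x ^ Suc n - y ^ Suc n)) sums (fps_apply F x - fps_apply F y)"
    using sums_Suc_iff[of "\<lambda>n. fps_nth F n *\<^sub>C x ^ n - fps_nth F n *\<^sub>C y ^ n"]
    by (simp add: bounded_bilinear.diff_right[OF bounded_bilinear_scaleC])
  have "(\<lambda>n. (x - y) * (fps_nth F (Suc n) *\<^sub>C power_divdiff n x y)) sums ((x - y) * divided_difference F x y)"
    by (intro sums_mult divided_difference_sums)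
  then show "(x - y) * divided_difference F x y = fps_apply F x - fps_apply F y"
    using s by (simp only: scaleC_mult_right power_divdiff_mult[OF assms] sums_unique2)
  have "(\<lambda>n. (fps_nth F (Suc n) *\<^sub>C power_divdiff n x y) * (x - y)) sums (divided_difference F x y * (x - y))"
    by (intro sums_mult2 divided_difference_sums)
  then show "divided_difference F x y * (x - y) = fps_apply F x - fps_apply F y"
    using s by (simp only: scaleC_mult_left power_divdiff_mult[OF assms] sums_unique2)
qed

lemma divided_difference_same: "divided_difference F x x = fps_apply (fps_deriv F) x"
proof -
  have "of_nat (Suc n) * x ^ n = of_nat (Suc n) *\<^sub>C x ^ n" for n
    using scaleC_of_real[of "real (Suc n)" "x ^ n"] scaleR_conv_of_real[of "real (Suc n)" "x ^ n"]
    by (simp only: of_real_of_nat_eq)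
  then show ?thesis
    unfolding divided_difference_def fps_apply_def
    by (simp only: power_divdiff_same scaleC_scaleC fps_deriv_nth mult.commute Suc_eq_plus1)
qed

lemma continuous_on_power_divdiff:
  fixes x y :: "'b::topological_space \<Rightarrow> 'a::complex_banach_algebra_1"
  assumes "continuous_on S x" "continuous_on S y"
  shows "continuous_on S (\<lambda>t. power_divdiff n (x t) (y t))"
  by (induction n) (auto intro!: continuous_intros assms)

lemma continuous_on_divided_difference:
  fixes x y :: "'b::topological_space \<Rightarrow> 'a::complex_banach_algebra_1"
  assumes "continuous_on S x" "continuous_on S y"
    and "\<And>t. t \<in> S \<Longrightarrow> norm (x t) \<le> \<rho>" "\<And>t. t \<in> S \<Longrightarrow> norm (y t) \<le> \<rho>" "0 \<le> \<rho>"
  shows "continuous_on S (\<lambda>t. divided_difference F (x t) (y t))"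
proof (rule uniform_limit_theorem)
  show "uniform_limit S (\<lambda>n t. \<Sum>i<n. fps_nth F (Suc i) *\<^sub>C power_divdiff i (x t) (y t))
      (\<lambda>t. divided_difference F (x t) (y t)) sequentially"
    unfolding divided_difference_def
    by (rule Weierstrass_m_test[OF norm_divdiff_term_le[where \<rho> = \<rho>] summable_divdiff_bound])
       (use assms in auto)
  show "\<forall>\<^sub>F n in sequentially. continuous_on S
      (\<lambda>t. \<Sum>i<n. fps_nth F (Suc i) *\<^sub>C power_divdiff i (x t) (y t))"
    by (intro always_eventually allI continuous_intros continuous_on_power_divdiff assms)
qed simp

end

lemma continuous_on_fps_apply:
  fixes x :: "'b::topological_space \<Rightarrow> 'a::complex_banach_algebra_1"
  assumes "continuous_on S x" "\<And>t. t \<in> S \<Longrightarrow> norm (x t) \<le> \<rho>" "abs_conv F \<rho>"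
  shows "continuous_on S (\<lambda>t. fps_apply F (x t))"
proof (rule uniform_limit_theorem)
  have "norm (fps_nth F n *\<^sub>C x t ^ n) \<le> cmod (fps_nth F n) * \<rho> ^ n" if "t \<in> S" for n t
    using norm_power_ineq[of "x t" n] power_mono[OF assms(2)[OF that], of n]
    unfolding norm_scaleC by (intro mult_left_mono) auto
  then show "uniform_limit S (\<lambda>n t. \<Sum>i<n. fps_nth F i *\<^sub>C x t ^ i) (\<lambda>t. fps_apply F (x t)) sequentially"
    unfolding fps_apply_def
    by (rule Weierstrass_m_test) (use assms(3) in \<open>auto simp: abs_conv_def\<close>)
  show "\<forall>\<^sub>F n in sequentially. continuous_on S (\<lambda>t. \<Sum>i<n. fps_nth F i *\<^sub>C x t ^ i)"
    by (intro always_eventually allI continuous_intros assms)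
qed simp

subsection \<open>Invertible elements\<close>

definition invertible_element :: "'a::ring_1 \<Rightarrow> bool" where
  "invertible_element x \<longleftrightarrow> (\<exists>y. x * y = 1 \<and> y * x = 1)"

lemma invertible_elementI: "x * y = 1 \<Longrightarrow> z * x = 1 \<Longrightarrow> invertible_element x"
  unfolding invertible_element_def by (metis mult.assoc mult.left_neutral mult.right_neutral)

lemma invertible_element_1 [simp]: "invertible_element 1"
  by (rule invertible_elementI[of _ 1 1]) simp_all

lemma invertible_element_mult:
  assumes "invertible_element x" "invertible_element y"
  shows "invertible_element (x * y)"
proof -
  obtain x' y' where *: "x * x' = 1" "x' * x = 1" "y * y' = 1" "y' * y = 1"
    using assms by (auto simp: invertible_element_def)
  have "x * y * (y' * x') = x * (y * y') * x'" "y' * x' * (x * y) = y' * (x' * x) * y"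
    by (simp_all only: mult.assoc)
  then show ?thesis by (intro invertible_elementI[of _ "y' * x'" "y' * x'"]) (simp_all add: *)
qed

lemma invertible_element_power: "invertible_element x \<Longrightarrow> invertible_element (x ^ n)"
  by (induction n) (auto intro: invertible_element_mult)

definition algebra_spectrum :: "'a::complex_banach_algebra_1 \<Rightarrow> complex set" where
  "algebra_spectrum a = {z. \<not> invertible_element (z *\<^sub>C 1 - a)}"

text \<open>The reciprocal \<open>1 / h\<close> has a power series that still converges at \<open>a\<close>, and evaluation is
multiplicative.\<close>

lemma invertible_fps_apply_nonvanishing:
  assumes h: "h holomorphic_on ball 0 R" and nz: "\<And>z. z \<in> ball 0 R \<Longrightarrow> h z \<noteq> 0" and a: "norm a < R"
  shows "invertible_element (fps_apply (fps_expansion h 0) a)"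
proof -
  let ?g = "\<lambda>z. inverse (h z)"
  have R: "0 < R" using a norm_ge_zero[of a] by linarith
  have g: "?g holomorphic_on ball 0 R" using h nz by (intro holomorphic_intros) auto
  have fh: "h has_fps_expansion fps_expansion h 0" and fg: "?g has_fps_expansion fps_expansion ?g 0"
    using h g R by (auto intro!: has_fps_expansion_fps_expansion[of "ball 0 R"])
  have conv: "abs_conv (fps_expansion k 0) (norm a)" if "k holomorphic_on ball 0 R" for k
    using less_le_trans[of "ereal (norm a)" "ereal R"] conv_radius_fps_expansion[of k 0 "ereal R"] that a
    by (intro abs_conv_in_radius) auto
  have "(\<lambda>z. h z * ?g z) has_fps_expansion fps_expansion h 0 * fps_expansion ?g 0"
    by (rule has_fps_expansion_mult[OF fh fg])
  moreover have "(\<lambda>z. h z * ?g z) has_fps_expansion 1"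
  proof -
    have "eventually (\<lambda>z. z \<in> ball 0 R) (nhds 0)" using R by (intro eventually_nhds_in_open) auto
    then have "eventually (\<lambda>z. h z * ?g z = 1) (nhds 0)" by eventually_elim (use nz in auto)
    then show ?thesis by (subst has_fps_expansion_cong[of _ "\<lambda>_. 1"]) auto
  qed
  ultimately have "fps_expansion h 0 * fps_expansion ?g 0 = 1" by (rule fps_expansion_unique_complex)
  then show ?thesis
    using fps_apply_mult[OF conv[OF h] conv[OF g]] fps_apply_mult[OF conv[OF g] conv[OF h]]
    by (intro invertible_elementI[of _ "fps_apply (fps_expansion ?g 0) a" "fps_apply (fps_expansion ?g 0) a"])
       (auto simp: mult.commute)
qed

text \<open>The geometric series is the formal inverse of \<open>z - X\<close>, so evaluating the product at \<open>a\<close> gives both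
identities at once.\<close>

lemma neumann_series:
  fixes a :: "'a::complex_banach_algebra_1"
  assumes "norm a < cmod z"
  defines "G \<equiv> Abs_fps (\<lambda>n. inverse z ^ Suc n)"
  shows "abs_conv G (norm a)"
    and "(z *\<^sub>C 1 - a) * fps_apply G a = 1" and "fps_apply G a * (z *\<^sub>C 1 - a) = 1"
proof -
  have z: "z \<noteq> 0" using assms by auto
  have "summable (\<lambda>n. inverse (cmod z) * (norm a / cmod z) ^ n)"
    using assms z by (intro summable_mult summable_geometric) auto
  also have "(\<lambda>n. inverse (cmod z) * (norm a / cmod z) ^ n)
      = (\<lambda>n. cmod (fps_nth G n) * norm a ^ n)"
    by (rule ext) (simp add: G_def norm_power norm_mult norm_inverse divide_inverse power_mult_distrib power_inverse)
  finally show G: "abs_conv G (norm a)" unfolding abs_conv_def .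
  let ?F = "fps_const z - fps_X"
  have F: "abs_conv ?F (norm a)" by (intro abs_conv_diff) auto
  have Fa: "fps_apply ?F a = z *\<^sub>C 1 - a"
    by (subst fps_apply_diff) (auto simp: fps_apply_const)
  have FG: "?F * G = 1"
  proof (rule fps_ext)
    fix n show "fps_nth (?F * G) n = fps_nth 1 n"
      using z by (cases n) (simp_all add: G_def left_diff_distrib fps_mult_nth_0)
  qed
  show "(z *\<^sub>C 1 - a) * fps_apply G a = 1"
    using fps_apply_mult[OF F G] by (simp add: FG Fa)
  show "fps_apply G a * (z *\<^sub>C 1 - a) = 1"
    using fps_apply_mult[OF G F] FG by (simp add: Fa mult.commute)
qed

lemma norm_le_of_mem_algebra_spectrum: "z \<in> algebra_spectrum a \<Longrightarrow> cmod z \<le> norm a"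
  using neumann_series(2,3)[of a z] invertible_elementI not_le
  by (fastforce simp: algebra_spectrum_def)

text \<open>The difference \<open>F(z) - F(a)\<close> has \<open>z - a\<close> as a factor. If the modulus of \<open>F(z)\<close> exceeded the norm of
\<open>F(a)\<close>, the difference would be invertible by the Neumann series, and hence so would \<open>z - a\<close>.\<close>

lemma norm_apply_ge_on_spectrum:
  fixes a :: "'a::complex_banach_algebra_1"
  assumes F: "fps_conv_radius F = \<infinity>" and z: "z \<in> algebra_spectrum a"
  shows "cmod (eval_fps F z) \<le> norm (fps_apply F a)"
proof (rule ccontr)
  assume "\<not> ?thesis"
  then obtain v where v: "(eval_fps F z *\<^sub>C 1 - fps_apply F a) * v = 1"
      "v * (eval_fps F z *\<^sub>C 1 - fps_apply F a) = 1"
    using neumann_series(2,3)[of "fps_apply F a" "eval_fps F z"] by (auto simp: not_le)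
  let ?z = "z *\<^sub>C (1::'a)"
  have c: "?z * a = a * ?z" by (simp add: scaleC_mult_left scaleC_mult_right)
  have "fps_apply F ?z = eval_fps F z *\<^sub>C 1"
  proof (rule fps_apply_eqI)
    have "(\<lambda>n. fps_nth F n * z ^ n) sums eval_fps F z" by (rule sums_eval_fps) (simp add: F)
    then have "(\<lambda>n. (fps_nth F n * z ^ n) *\<^sub>C (1::'a)) sums (eval_fps F z *\<^sub>C 1)"
      by (rule bounded_linear.sums[OF bounded_bilinear.bounded_linear_left[OF bounded_bilinear_scaleC]])
    then show "(\<lambda>n. fps_nth F n *\<^sub>C ?z ^ n) sums (eval_fps F z *\<^sub>C 1)"
      by (simp add: scaleC_power scaleC_scaleC)
  qed
  then have "(?z - a) * (divided_difference F ?z a * v) = 1"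
      "(v * divided_difference F ?z a) * (?z - a) = 1"
    using divided_difference_mult[OF F c] v by (simp_all add: mult.assoc[symmetric]) (simp add: mult.assoc)
  then have "invertible_element (?z - a)" by (rule invertible_elementI)
  then show False using z by (simp add: algebra_spectrum_def)
qed

lemma entire_factor_zero:
  assumes h: "h holomorphic_on UNIV" and "h a = 0" "h b \<noteq> 0"
  obtains g n where "g holomorphic_on UNIV" "g a \<noteq> 0" "\<And>w::complex. h w = (w - a) ^ n * g w"
proof -
  define n where "n = nat (zorder h a)"
  have "\<exists>w\<in>UNIV. h w \<noteq> 0" using assms(3) by blast
  then have "\<exists>r>0. cball a r \<subseteq> UNIV \<and> zor_poly h a holomorphic_on cball a r \<and>
      (\<forall>w\<in>cball a r. h w = zor_poly h a w * (w - a) ^ n \<and> zor_poly h a w \<noteq> 0)"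
    using zorder_exist_zero[OF h open_UNIV connected_UNIV, of a] by (simp add: n_def)
  then obtain r where r: "r > 0" "zor_poly h a holomorphic_on cball a r"
      "\<And>w. w \<in> cball a r \<Longrightarrow> h w = zor_poly h a w * (w - a) ^ n \<and> zor_poly h a w \<noteq> 0"
    by blast
  define g where "g w = (if w = a then zor_poly h a a else h w / (w - a) ^ n)" for w
  have ha: "h w = (w - a) ^ n * g w" for w
    using r(3)[of a] r(1) by (auto simp: g_def)
  have "g holomorphic_on ball a r \<union> - {a}"
  proof (rule holomorphic_on_Un)
    have "zor_poly h a w = g w" if "w \<in> ball a r" for w
      using r(3)[of w] that by (simp add: g_def)
    then show "g holomorphic_on ball a r"
      by (rule holomorphic_transform[OF holomorphic_on_subset[OF r(2) ball_subset_cball]])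
    have "(\<lambda>w. h w / (w - a) ^ n) holomorphic_on - {a}"
      by (intro holomorphic_intros holomorphic_on_subset[OF h]) auto
    then show "g holomorphic_on - {a}" by (rule holomorphic_transform) (auto simp: g_def)
  qed auto
  moreover have "ball a r \<union> - {a} = UNIV" using r(1) by auto
  moreover have "g a \<noteq> 0" using r(3)[of a] r(1) by (simp add: g_def)
  ultimately show ?thesis using that[of g n] ha by metis
qed

lemma fps_apply_expansion_mult:
  assumes "g holomorphic_on UNIV" "h holomorphic_on UNIV"
  shows "fps_apply (fps_expansion (\<lambda>w. g w * h w) 0) a
    = fps_apply (fps_expansion g 0) a * fps_apply (fps_expansion h 0) a"
proof -
  have e: "k has_fps_expansion fps_expansion k 0" "abs_conv (fps_expansion k 0) (norm a)"
    if "k holomorphic_on UNIV" for k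
    using that conv_radius_fps_expansion[of k 0 \<infinity>]
    by (auto intro!: abs_conv_in_radius has_fps_expansion_fps_expansion[of UNIV])
  have "fps_expansion (\<lambda>w. g w * h w) 0 = fps_expansion g 0 * fps_expansion h 0"
    by (intro fps_expansion_eqI has_fps_expansion_mult e assms)
  then show ?thesis by (simp add: fps_apply_mult e assms)
qed

text \<open>Only finitely many zeros of \<open>h\<close> lie in a disc slightly larger than that of radius \<open>\<parallel>a\<parallel>\<close>. Splitting
them off one at a time leaves factors \<open>w - c\<close> with \<open>c\<close> outside the spectrum, whose values are
invertible by definition, and a function without zeros on the disc. This elementary route avoids
the spectral radius formula.\<close>

theorem invertible_fps_apply_entire:
  fixes a :: "'a::complex_banach_algebra_1"
  assumes "h holomorphic_on UNIV" "h b \<noteq> 0" "\<And>z. z \<in> algebra_spectrum a \<Longrightarrow> h z \<noteq> 0"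
  shows "invertible_element (fps_apply (fps_expansion h 0) a)"
proof -
  define R where "R = norm a + 1"
  have "finite {z \<in> cball 0 R. h z = 0}"
    if "h holomorphic_on UNIV" "h b \<noteq> 0" for h :: "complex \<Rightarrow> complex" and b
  proof (cases "\<exists>c. h c = 0")
    case True
    then show ?thesis
      using that by (intro holomorphic_compact_finite_zeros[where S = UNIV])
        (auto simp: constant_on_def, metis)
  qed simp
  moreover have "invertible_element (fps_apply (fps_expansion h 0) a)"
    if "h holomorphic_on UNIV" "h b \<noteq> 0" "\<And>z. z \<in> algebra_spectrum a \<Longrightarrow> h z \<noteq> 0"
      "finite {z \<in> cball 0 R. h z = 0}" for h b
    using that
  proof (induction "card {z \<in> cball 0 R. h z = 0}" arbitrary: h b rule: less_induct)
    case less
    show ?case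
    proof (cases "{z \<in> cball 0 R. h z = 0} = {}")
      case True
      have "cball (0::complex) R \<supseteq> ball 0 R" by (rule ball_subset_cball)
      then have "h z \<noteq> 0" if "z \<in> ball 0 R" for z using True that by blast
      then show ?thesis
        using less.prems(1) by (intro invertible_fps_apply_nonvanishing[of h R])
          (auto simp: R_def intro: holomorphic_on_subset)
    next
      case False
      then obtain c where c: "c \<in> cball 0 R" "h c = 0" by auto
      obtain g n where g: "g holomorphic_on UNIV" "g c \<noteq> 0" "\<And>w. h w = (w - c) ^ n * g w"
        using entire_factor_zero[OF less.prems(1) c(2) less.prems(2)] by metis
      have sub: "{z \<in> cball 0 R. g z = 0} \<subset> {z \<in> cball 0 R. h z = 0}"
        using g c by auto
      have "invertible_element (fps_apply (fps_expansion g 0) a)"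
        using sub less.prems(3) g
        by (intro less.hyps[OF psubset_card_mono[OF less.prems(4) sub], of c])
           (auto intro: finite_subset[OF _ less.prems(4)])
      moreover have "invertible_element (fps_apply (fps_expansion (\<lambda>w. (w - c) ^ n) 0) a)"
      proof -
        have "(\<lambda>w. (w - c) ^ n) has_fps_expansion (fps_X - fps_const c) ^ n"
          by (intro fps_expansion_intros)
        then have "fps_expansion (\<lambda>w. (w - c) ^ n) 0 = (fps_X - fps_const c) ^ n"
          by (rule fps_expansion_eqI)
        moreover have "fps_apply ((fps_X - fps_const c) ^ n) a = (a - c *\<^sub>C 1) ^ n"
          by (simp add: fps_apply_power abs_conv_diff fps_apply_diff fps_apply_const)
        moreover have "c \<notin> algebra_spectrum a" using less.prems(3) c by blast
        then have "invertible_element ((-1) * (c *\<^sub>C 1 - a))"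
          by (intro invertible_element_mult) (auto simp: algebra_spectrum_def intro!: invertible_elementI[of _ "-1" "-1"])
        then have "invertible_element (a - c *\<^sub>C 1)" by simp
        ultimately show ?thesis by (simp add: invertible_element_power)
      qed
      moreover have "h = (\<lambda>w. (w - c) ^ n * g w)" using g(3) by auto
      moreover have "(\<lambda>w. (w - c) ^ n) holomorphic_on UNIV" by (intro holomorphic_intros)
      ultimately show ?thesis
        by (simp add: fps_apply_expansion_mult g(1) invertible_element_mult)
    qed
  qed
  ultimately show ?thesis using assms by blast
qed

section \<open>Inverting an entire function on a ray of operators\<close>

lemma fps_apply_commute:
  assumes "abs_conv F (norm x)" "x * y = y * x"
  shows "fps_apply F x * y = y * fps_apply F x"
proof -
  have "(\<lambda>n. (fps_nth F n *\<^sub>C x ^ n) * y) sums (fps_apply F x * y)"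
    by (intro sums_mult2 fps_apply_sums assms)
  moreover have "(\<lambda>n. y * (fps_nth F n *\<^sub>C x ^ n)) sums (y * fps_apply F x)"
    by (intro sums_mult fps_apply_sums assms)
  moreover have "(fps_nth F n *\<^sub>C x ^ n) * y = y * (fps_nth F n *\<^sub>C x ^ n)" for n
    by (simp add: scaleC_mult_left scaleC_mult_right power_commuting_commutes[OF assms(2)])
  ultimately show ?thesis using sums_unique2 by (metis (no_types, lifting) sums_cong)
qed

text \<open>The parameters \<open>t\<close> at which the two sides agree form a closed set containing \<open>0\<close>. Near such a \<open>t\<close>
the divided difference \<open>H\<close> of \<open>F\<close> at the two sides is close to \<open>F'(t a)\<close>, so an inverse of the latter is an
approximate right inverse of \<open>H\<close>; as \<open>H\<close> annihilates the difference of the two sides, that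
difference vanishes. Absolute convergence of \<open>G\<close> at \<open>\<rho>\<close> suffices, the norm may equal \<open>\<rho>\<close>.\<close>

theorem fps_inverse_along_ray:
  fixes a :: "'a::complex_banach_algebra_1"
  assumes F: "fps_conv_radius F = \<infinity>" "fps_nth F 0 = 0"
    and G: "abs_conv G \<rho>" "fps_nth G 0 = 0" and FG: "F oo G = fps_X"
    and bound: "\<And>t. t \<in> {0..T} \<Longrightarrow> norm (fps_apply F (t *\<^sub>R a)) \<le> \<rho>"
    and inv: "\<And>t. t \<in> {0..T} \<Longrightarrow> invertible_element (fps_apply (fps_deriv F) (t *\<^sub>R a))"
    and "0 \<le> T"
  shows "fps_apply G (fps_apply F (T *\<^sub>R a)) = T *\<^sub>R a"
proof -
  define g where "g t = fps_apply G (fps_apply F (t *\<^sub>R a))" for t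
  define H where "H t = divided_difference F (g t) (t *\<^sub>R a)" for t
  let ?I = "{0..T}"
  note abs_F = abs_conv_entire[OF F(1)]
  have \<rho>: "0 \<le> \<rho>" using order_trans[OF norm_ge_zero bound[of 0]] \<open>0 \<le> T\<close> by simp
  define w where "w = weighted_norm G \<rho>"
  have w: "0 \<le> w" unfolding w_def by (rule weighted_norm_nonneg[OF G(1) \<rho>])
  have gw: "norm (g t) \<le> w" if "t \<in> ?I" for t
    unfolding g_def w_def by (rule norm_fps_apply_le[OF G(1) bound[OF that]])
  have ta: "norm (t *\<^sub>R a) \<le> T * norm a" if "t \<in> ?I" for t
    using that by (auto intro: mult_right_mono)
  have cont_ta: "continuous_on ?I (\<lambda>t. t *\<^sub>R a)" by (intro continuous_intros)
  have cont_F: "continuous_on ?I (\<lambda>t. fps_apply F (t *\<^sub>R a))"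
    by (rule continuous_on_fps_apply[OF cont_ta ta abs_F]) (use \<open>0 \<le> T\<close> in auto)
  have cont_g: "continuous_on ?I g"
    unfolding g_def by (rule continuous_on_fps_apply[OF cont_F bound G(1)])
  have cont_H: "continuous_on ?I H"
    unfolding H_def
    by (rule continuous_on_divided_difference[OF F(1) cont_g cont_ta, where \<rho> = "max w (T * norm a)"])
       (use gw ta w in \<open>auto simp: le_max_iff_disj\<close>)
  have vanish: "(g t - t *\<^sub>R a) * H t = 0" if t: "t \<in> ?I" for t
  proof -
    have "fps_apply F (g t) = fps_apply F (t *\<^sub>R a)"
      unfolding g_def using abs_F[OF w] unfolding w_def
      by (subst fps_apply_compose[OF G(1) bound[OF t] G(2)]) (simp_all add: FG)
    moreover have "fps_apply F (t *\<^sub>R a) * t *\<^sub>R a = t *\<^sub>R a * fps_apply F (t *\<^sub>R a)"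
      by (rule fps_apply_commute) (auto intro: abs_F)
    then have "g t * t *\<^sub>R a = t *\<^sub>R a * g t"
      unfolding g_def by (intro fps_apply_commute[OF abs_conv_mono[OF G(1) norm_ge_zero bound[OF t]]])
    ultimately show ?thesis
      unfolding H_def using divided_difference_mult(1)[OF F(1), of "g t" "t *\<^sub>R a"] by simp
  qed
  define S where "S = {t \<in> ?I. g t - t *\<^sub>R a = 0}"
  have "closedin (top_of_set ?I) S"
    unfolding S_def by (intro continuous_closedin_preimage_constant continuous_intros cont_g cont_ta)
  moreover have "openin (top_of_set ?I) S"
  proof (subst openin_subopen, intro ballI)
    fix t0 assume t0: "t0 \<in> S"
    then have t0I: "t0 \<in> ?I" by (simp add: S_def)
    have "H t0 = fps_apply (fps_deriv F) (t0 *\<^sub>R a)"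
      using t0 divided_difference_same[OF F(1)] by (simp add: H_def S_def)
    then obtain u where u: "H t0 * u = 1" using inv[OF t0I] by (auto simp: invertible_element_def)
    define V where "V = ?I \<inter> (\<lambda>t. norm (1 - H t * u)) -` {..<1}"
    have "openin (top_of_set ?I) V"
      unfolding V_def by (intro continuous_openin_preimage_gen continuous_intros cont_H)
    moreover have "t0 \<in> V" using t0I u by (simp add: V_def)
    moreover have "V \<subseteq> S"
    proof
      fix t assume t: "t \<in> V"
      then have tI: "t \<in> ?I" and lt: "norm (1 - H t * u) < 1" by (auto simp: V_def)
      \<comment> \<open>A factor of norm below one cannot fix a non-zero element.\<close>
      define d where "d = g t - t *\<^sub>R a"
      have "d = d * (1 - H t * u)"
        using vanish[OF tI] by (simp add: d_def right_diff_distrib mult.assoc[symmetric])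
      then have "norm d \<le> norm d * norm (1 - H t * u)" by (metis norm_mult_ineq)
      then have "norm d * (1 - norm (1 - H t * u)) \<le> 0" by (simp add: right_diff_distrib)
      then have "norm d = 0"
        using lt by (simp add: mult_le_0_iff)
      then show "t \<in> S" using tI by (simp add: S_def d_def)
    qed
    ultimately show "\<exists>V. openin (top_of_set ?I) V \<and> t0 \<in> V \<and> V \<subseteq> S" by blast
  qed
  ultimately have "S = {} \<or> S = ?I"
    using connected_clopen[of ?I] connected_Icc by blast
  moreover have "0 \<in> S"
    using \<open>0 \<le> T\<close> F(2) G(2) by (simp add: S_def g_def fps_apply_zero)
  ultimately have "T \<in> S" using \<open>0 \<le> T\<close> by auto
  then show ?thesis by (simp add: S_def g_def)
qed

lemma mem_algebra_spectrum_scaleR: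
  fixes a :: "'a::complex_banach_algebra_1"
  assumes "z \<in> algebra_spectrum (t *\<^sub>R a)" "t > 0"
  shows "z / of_real t \<in> algebra_spectrum a"
proof -
  have eq: "z *\<^sub>C 1 - t *\<^sub>R a = (complex_of_real t *\<^sub>C 1) * ((z / of_real t) *\<^sub>C 1 - a)"
    using \<open>t > 0\<close>
    by (simp only: scaleC_of_real[symmetric, of t a] scaleC_mult_left mult_1_left scaleC_scaleC
        bounded_bilinear.diff_right[OF bounded_bilinear_scaleC]) simp
  have "invertible_element (complex_of_real t *\<^sub>C (1::'a))"
    using \<open>t > 0\<close>
    by (intro invertible_elementI[of _ "inverse (of_real t) *\<^sub>C 1" "inverse (of_real t) *\<^sub>C 1"])
       (simp_all add: scaleC_mult_left scaleC_mult_right scaleC_scaleC)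
  then show ?thesis
    using assms(1) invertible_element_mult[of "complex_of_real t *\<^sub>C (1::'a)"]
    by (auto simp: algebra_spectrum_def eq)
qed

theorem norm_le_of_bounded_ray:
  fixes a :: "'a::complex_banach_algebra_1"
  assumes f: "f holomorphic_on UNIV" "f 0 = 0" "deriv f 0 \<noteq> 0"
    and G: "abs_conv G \<rho>" "fps_nth G 0 = 0" and fG: "fps_expansion f 0 oo G = fps_X"
    and bound: "\<And>t. t > 0 \<Longrightarrow> norm (fps_apply (fps_expansion f 0) (t *\<^sub>R a)) \<le> \<rho>"
    and inv: "\<And>t z. 0 < t \<Longrightarrow> t \<le> T \<Longrightarrow> z \<in> algebra_spectrum a \<Longrightarrow> deriv f (of_real t * z) \<noteq> 0"
    and "0 < T"
  shows "T * norm a \<le> weighted_norm G \<rho>"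
proof -
  let ?F = "fps_expansion f 0"
  have F: "fps_conv_radius ?F = \<infinity>" "fps_nth ?F 0 = 0"
    using conv_radius_fps_expansion[of f 0 \<infinity>] f by (auto simp: fps_expansion_def)
  have hf: "f has_fps_expansion ?F" using f by (intro has_fps_expansion_fps_expansion[of UNIV]) auto
  have dF: "fps_deriv ?F = fps_expansion (deriv f) 0"
    by (rule fps_expansion_eqI[symmetric, OF has_fps_expansion_deriv[OF hf]])
  have hd: "deriv f holomorphic_on UNIV" using f by (intro holomorphic_deriv) auto
  have \<rho>: "0 \<le> \<rho>" using order_trans[OF norm_ge_zero bound[of 1]] by simp
  have bound': "norm (fps_apply ?F (t *\<^sub>R a)) \<le> \<rho>" if "t \<in> {0..T}" for t
    using bound[of t] that \<rho> F(2) by (cases "t = 0") (auto simp: fps_apply_zero)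
  have "invertible_element (fps_apply (fps_deriv ?F) (t *\<^sub>R a))" if t: "t \<in> {0..T}" for t
    unfolding dF
  proof (rule invertible_fps_apply_entire[OF hd f(3)])
    fix z assume z: "z \<in> algebra_spectrum (t *\<^sub>R a)"
    show "deriv f z \<noteq> 0"
    proof (cases "t = 0")
      case True
      then show ?thesis using norm_le_of_mem_algebra_spectrum[OF z] f(3) by simp
    next
      case False
      then show ?thesis using inv[of t "z / of_real t"] mem_algebra_spectrum_scaleR[OF z] t by simp
    qed
  qed
  then have "fps_apply G (fps_apply ?F (T *\<^sub>R a)) = T *\<^sub>R a"
    by (intro fps_inverse_along_ray[OF F G fG bound']) (use \<open>0 < T\<close> in auto)
  moreover have "norm (fps_apply G (fps_apply ?F (T *\<^sub>R a))) \<le> weighted_norm G \<rho>"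
    using \<open>0 < T\<close> by (intro norm_fps_apply_le[OF G(1)] bound) auto
  ultimately show ?thesis using \<open>0 < T\<close> by simp
qed

section \<open>Power series with non-negative coefficients\<close>

lemma higher_fps_deriv_nth:
  fixes F :: "complex fps"
  shows "fact n * fps_nth ((fps_deriv ^^ k) F) n = fact (n + k) * fps_nth F (n + k)"
proof (induction k arbitrary: n)
  case (Suc k)
  have "fact n * fps_nth ((fps_deriv ^^ Suc k) F) n = fact (Suc n) * fps_nth ((fps_deriv ^^ k) F) (Suc n)"
    by (simp add: algebra_simps)
  also have "\<dots> = fact (n + Suc k) * fps_nth F (n + Suc k)" using Suc[of "Suc n"] by simp
  finally show ?case .
qed simp

text \<open>The Taylor coefficients about a point \<open>z\<close> in terms of those about \<open>0\<close>, in a form whose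
non-negativity is visible when the coefficients and \<open>z\<close> are non-negative.\<close>

lemma taylor_coefficient_eval_fps:
  fixes F :: "complex fps"
  assumes "ereal (cmod z) < fps_conv_radius F"
  shows "(\<lambda>n. of_nat ((n + k) choose k) * fps_nth F (n + k) * z ^ n)
    sums ((deriv ^^ k) (eval_fps F) z / fact k)"
proof -
  have *: "fps_conv_radius F \<le> fps_conv_radius ((fps_deriv ^^ k) F)
      \<and> (\<forall>z. ereal (cmod z) < fps_conv_radius F \<longrightarrow>
          (deriv ^^ k) (eval_fps F) z = eval_fps ((fps_deriv ^^ k) F) z)"
  proof (induction k)
    case (Suc k)
    let ?H = "(fps_deriv ^^ k) F"
    have "(deriv ^^ Suc k) (eval_fps F) z = eval_fps ((fps_deriv ^^ Suc k) F) z"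
      if z: "ereal (cmod z) < fps_conv_radius F" for z
    proof -
      have "eventually (\<lambda>w. w \<in> eball 0 (fps_conv_radius F)) (nhds z)"
        using z by (intro eventually_nhds_in_open) auto
      then have "eventually (\<lambda>w. (deriv ^^ k) (eval_fps F) w = eval_fps ?H w) (nhds z)"
        by eventually_elim (use Suc in auto)
      then have "(deriv ^^ Suc k) (eval_fps F) z = deriv (eval_fps ?H) z"
        by (simp add: deriv_cong_ev)
      also have "\<dots> = eval_fps (fps_deriv ?H) z"
        by (rule eval_fps_deriv[symmetric]) (use z Suc less_le_trans in blast)
      finally show ?thesis by simp
    qed
    then show ?case using Suc fps_conv_radius_deriv[of ?H] by (auto intro: order_trans)
  qed simp
  let ?H = "(fps_deriv ^^ k) F"
  have "(\<lambda>n. fps_nth ?H n * z ^ n) sums eval_fps ?H z"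
    using * assms by (intro sums_eval_fps) (auto intro: less_le_trans)
  then have "(\<lambda>n. fps_nth ?H n * z ^ n / fact k) sums ((deriv ^^ k) (eval_fps F) z / fact k)"
    using * assms by (intro sums_divide) simp
  also have "(\<lambda>n. fps_nth ?H n * z ^ n / fact k)
      = (\<lambda>n. of_nat ((n + k) choose k) * fps_nth F (n + k) * z ^ n)"
  proof (rule ext)
    fix n
    have "fps_nth ?H n = fact (n + k) * fps_nth F (n + k) / fact n"
      using higher_fps_deriv_nth[of n k F] by (simp add: field_simps)
    moreover have "of_nat ((n + k) choose k) = (fact (n + k) / (fact k * fact n) :: complex)"
      using binomial_fact[of k "n + k", where 'a = complex] by simp
    ultimately show "fps_nth ?H n * z ^ n / fact k
        = of_nat ((n + k) choose k) * fps_nth F (n + k) * z ^ n"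
      by (simp only: divide_inverse mult_ac inverse_mult_distrib)
  qed
  finally show ?thesis .
qed

text \<open>If the sum continued holomorphically to \<open>\<psi>\<close> near \<open>R\<close>, its Taylor series about a point \<open>s < R\<close> close to
\<open>R\<close> would converge at some \<open>s + h > R\<close>. All terms being non-negative, re-expanding that series
about \<open>0\<close> is legitimate and shows that the original series converges at \<open>s + h\<close>.\<close>

theorem vivanti_pringsheim:
  fixes G :: "complex fps" and c :: "nat \<Rightarrow> real"
  assumes G: "\<And>n. fps_nth G n = of_real (c n)" "\<And>n. 0 \<le> c n"
    and R: "fps_conv_radius G = ereal R" "0 < R"
    and \<psi>: "\<psi> holomorphic_on ball (of_real R) \<epsilon>" "0 < \<epsilon>"
    and eq: "\<And>z. z \<in> ball (of_real R) \<epsilon> \<Longrightarrow> cmod z < R \<Longrightarrow> \<psi> z = eval_fps G z"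
  shows False
proof -
  \<comment> \<open>Expand about \<open>s\<close> slightly to the left of \<open>R\<close>, in a disc that lies in the domain of \<open>\<psi>\<close> and reaches
    the point \<open>s + h\<close> beyond \<open>R\<close>.\<close>
  define d where "d = min \<epsilon> R"
  define s where "s = R - d / 4"
  define h where "h = 3 * d / 8"
  have d: "0 < d" "d \<le> \<epsilon>" "d \<le> R" using R \<psi> by (auto simp: d_def)
  have s: "0 \<le> s" "s < R" and h: "0 \<le> h" and sh: "s + h = R + d / 8"
    using d by (auto simp: s_def h_def)
  let ?s = "of_real s :: complex"
  define D where "D k = Re ((deriv ^^ k) (eval_fps G) ?s / fact k)" for k
  have tay: "(\<lambda>n. of_nat ((n + k) choose k) * fps_nth G (n + k) * ?s ^ n)
      sums ((deriv ^^ k) (eval_fps G) ?s / fact k)" for k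
    by (rule taylor_coefficient_eval_fps) (use R s in simp)
  have D: "(\<lambda>n. real ((n + k) choose k) * c (n + k) * s ^ n) sums D k" for k
    using bounded_linear.sums[OF bounded_linear_Re tay[of k]] by (simp add: D_def G)
  have real_coeff: "(deriv ^^ k) (eval_fps G) ?s / fact k = of_real (D k)" for k
    using bounded_linear.sums[OF bounded_linear_Im tay[of k]]
    by (simp add: D_def complex_eq_iff G sums_0 sums_iff)
  have "ball ?s (d / 2) \<subseteq> ball (of_real R) \<epsilon>"
  proof (rule ball_subset_ball_iff[THEN iffD2], rule disjI1)
    have "dist ?s (of_real R) = d / 4"
      using d by (simp add: s_def dist_norm norm_minus_commute flip: of_real_diff)
    then show "dist ?s (of_real R) + d / 2 \<le> \<epsilon>" using d by simp
  qed
  then have h\<psi>: "\<psi> holomorphic_on ball ?s (d / 2)" by (rule holomorphic_on_subset[OF \<psi>(1)])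
  have same: "(deriv ^^ k) \<psi> ?s = (deriv ^^ k) (eval_fps G) ?s" for k
  proof (rule higher_deriv_transform_within_open[of _ "ball (of_real R) \<epsilon> \<inter> ball 0 R"])
    show "\<psi> holomorphic_on ball (of_real R) \<epsilon> \<inter> ball 0 R"
      by (rule holomorphic_on_subset[OF \<psi>(1)]) auto
    show "eval_fps G holomorphic_on ball (of_real R) \<epsilon> \<inter> ball 0 R"
      by (rule holomorphic_on_eval_fps) (use R in auto)
    have "dist (of_real R) ?s = d / 4"
      using d by (simp add: s_def dist_norm flip: of_real_diff)
    then show "?s \<in> ball (of_real R) \<epsilon> \<inter> ball 0 R" using d s by simp
  qed (auto simp: eq)
  have "dist ?s (of_real (s + h)) < d / 2"
    using d h by (simp add: dist_norm h_def)
  then have "(\<lambda>k. (deriv ^^ k) \<psi> ?s / fact k * (of_real (s + h) - ?s) ^ k) sums \<psi> (of_real (s + h))"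
    by (intro holomorphic_power_series[OF h\<psi>]) simp
  then have "(\<lambda>k. of_real (D k * h ^ k)) sums \<psi> (of_real (s + h))"
    by (simp add: same real_coeff)
  then have Dh: "summable (\<lambda>k. D k * h ^ k)"
    using summable_Re[OF sums_summable] by fastforce
  have Dnn: "0 \<le> D k" for k
    using sums_le[OF _ sums_zero D[of k]] G(2) s by simp
  \<comment> \<open>Rearranging a finite partial sum about \<open>s\<close> only drops non-negative terms of the derivatives \<open>D k\<close>.\<close>
  have "(\<Sum>n<N. c n * (s + h) ^ n) \<le> (\<Sum>k. D k * h ^ k)" for N
  proof -
    have "(\<Sum>n<N. c n * (s + h) ^ n) = (\<Sum>n<N. \<Sum>k<N. c n * (real (n choose k) * s ^ (n - k)) * h ^ k)"
    proof (intro sum.cong refl)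
      fix n assume "n \<in> {..<N}"
      have "c n * (s + h) ^ n = (\<Sum>k\<le>n. c n * (real (n choose k) * s ^ (n - k)) * h ^ k)"
        using binomial_ring[of h s n] by (simp add: sum_distrib_left add.commute mult_ac)
      also have "\<dots> = (\<Sum>k<N. c n * (real (n choose k) * s ^ (n - k)) * h ^ k)"
        using \<open>n \<in> {..<N}\<close> by (intro sum.mono_neutral_left) auto
      finally show "c n * (s + h) ^ n = \<dots>" .
    qed
    also have "\<dots> = (\<Sum>k<N. (\<Sum>n<N. c n * (real (n choose k) * s ^ (n - k))) * h ^ k)"
      unfolding sum_distrib_right by (rule sum.swap)
    also have "\<dots> \<le> (\<Sum>k<N. D k * h ^ k)"
    proof (intro sum_mono mult_right_mono)
      fix k assume k: "k \<in> {..<N}"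
      have "(\<Sum>n<N. c n * (real (n choose k) * s ^ (n - k)))
          = (\<Sum>n\<in>{k..<N}. c n * (real (n choose k) * s ^ (n - k)))"
        by (intro sum.mono_neutral_right) auto
      also have "\<dots> = (\<Sum>m<N - k. c (m + k) * (real ((m + k) choose k) * s ^ m))"
        using sum.shift_bounds_nat_ivl[of "\<lambda>n. c n * (real (n choose k) * s ^ (n - k))" 0 k "N - k"] k
        by (simp add: atLeast0LessThan)
      also have "\<dots> = (\<Sum>m<N - k. real ((m + k) choose k) * c (m + k) * s ^ m)"
        by (simp add: mult_ac)
      also have "\<dots> \<le> D k"
        unfolding sums_unique[OF D] by (intro sum_le_suminf sums_summable[OF D]) (use G(2) s in auto)
      finally show "(\<Sum>n<N. c n * (real (n choose k) * s ^ (n - k))) \<le> D k" .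
    qed (use h in simp)
    also have "\<dots> \<le> (\<Sum>k. D k * h ^ k)"
      using Dh Dnn h by (intro sum_le_suminf) auto
    finally show ?thesis .
  qed
  then have "summable (\<lambda>n. c n * (s + h) ^ n)"
    using G(2) s h by (intro summableI_nonneg_bounded[where x = "\<Sum>k. D k * h ^ k"]) auto
  then have "summable (\<lambda>n. complex_of_real (c n * (s + h) ^ n))"
    by (rule summable_of_real)
  then have "summable (\<lambda>n. fps_nth G n * of_real (s + h) ^ n)" by (simp add: G)
  from conv_radius_geI[OF this] have "ereal (norm (complex_of_real (s + h))) \<le> ereal R"
    using R by (simp add: fps_conv_radius_def)
  then have "\<bar>s + h\<bar> \<le> R" by (simp only: norm_of_real ereal_less_eq)
  then show False using sh d by linarith
qed

section \<open>The inverse germ of a function in the class P\<close>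

text \<open>Analytic continuation: on the component of \<open>0\<close> in the open set where \<open>f\<close> takes values in the disc of
convergence, the germ identity persists. The conclusion is stated on an open neighbourhood so that
it may be differentiated.\<close>

lemma eval_inverse_fps_on_connected:
  fixes f :: "complex \<Rightarrow> complex"
  assumes f: "f holomorphic_on UNIV" "f 0 = 0"
    and near0: "\<forall>\<^sub>F z in nhds 0. eval_fps G (f z) = z"
    and K: "connected K" "0 \<in> K" "\<And>z. z \<in> K \<Longrightarrow> ereal (cmod (f z)) < fps_conv_radius G"
  obtains U where "open U" "K \<subseteq> U" "\<And>z. z \<in> U \<Longrightarrow> eval_fps G (f z) = z"
    "\<And>z. z \<in> U \<Longrightarrow> ereal (cmod (f z)) < fps_conv_radius G"
proof -
  let ?E = "eball 0 (fps_conv_radius G) :: complex set"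
  define V where "V = f -` ?E"
  define U where "U = connected_component_set V 0"
  have cont: "continuous_on UNIV f" using f by (rule_tac holomorphic_on_imp_continuous_on)
  have "open V" unfolding V_def by (rule open_vimage[OF open_eball cont])
  then have oU: "open U" unfolding U_def by (rule open_connected_component)
  have "K \<subseteq> V" using K(3) by (auto simp: V_def)
  then have KU: "K \<subseteq> U" unfolding U_def by (intro connected_component_maximal K)
  have UV: "U \<subseteq> V" unfolding U_def by (rule connected_component_subset)
  have U0: "0 \<in> U" using KU K(2) by blast
  have "eval_fps G \<circ> f holomorphic_on U"
    by (rule holomorphic_on_compose_gen[OF holomorphic_on_subset[OF f(1)] holomorphic_on_eval_fps[OF subset_refl]])
       (use UV in \<open>auto simp: V_def\<close>)
  then have hol: "(\<lambda>z. eval_fps G (f z) - z) holomorphic_on U"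
    unfolding o_def by (intro holomorphic_intros)
  obtain W where W: "open W" "0 \<in> W" "\<And>z. z \<in> W \<Longrightarrow> eval_fps G (f z) = z"
    using near0 unfolding eventually_nhds by blast
  have "eval_fps G (f z) - z = 0" if "z \<in> U" for z
  proof (rule analytic_continuation_open[of "W \<inter> U" U "\<lambda>z. eval_fps G (f z) - z" "\<lambda>_. 0"])
    show "connected U" unfolding U_def by (rule connected_connected_component)
  qed (use W oU U0 hol that in auto)
  then have "eval_fps G (f z) = z" if "z \<in> U" for z using that by simp
  moreover have "ereal (cmod (f z)) < fps_conv_radius G" if "z \<in> U" for z
    using UV that by (auto simp: V_def)
  ultimately show ?thesis by (rule that[OF oU KU])
qed

text \<open>The scalar situation: \<open>G\<close> is the power series of the inverse germ of \<open>f\<close>, and \<open>\<xi>\<close> is at most the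
first critical point of \<open>f\<close> on the positive axis.\<close>

locale positive_inverse_germ =
  fixes f :: "complex \<Rightarrow> complex" and G :: "complex fps" and \<xi> :: real
  assumes holo: "f holomorphic_on UNIV" and f0: "f 0 = 0"
    and real_on_reals: "\<And>x::real. f (of_real x) \<in> \<real>"
    and radius: "fps_conv_radius G > 0"
    and coeff_nonneg: "\<And>n. fps_nth G n \<in> \<real>\<^sub>\<ge>\<^sub>0"
    and coeff0: "fps_nth G 0 = 0"
    and near0: "\<forall>\<^sub>F z in nhds 0. eval_fps G (f z) = z"
    and \<xi>_pos: "\<xi> > 0"
    and no_critical: "\<And>x::real. 0 \<le> x \<Longrightarrow> x < \<xi> \<Longrightarrow> deriv f (of_real x) \<noteq> 0"
begin

definition crit_val :: real where "crit_val = Re (f (of_real \<xi>))"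

definition real_f :: "real \<Rightarrow> real" where "real_f x = Re (f (of_real x))"

lemma f_of_real: "f (of_real x) = of_real (real_f x)"
  using real_on_reals[of x] by (auto simp: real_f_def elim!: Reals_cases)

lemma real_f_0: "real_f 0 = 0" by (simp add: real_f_def f0)

lemma real_f_\<xi>: "real_f \<xi> = crit_val" by (simp add: real_f_def crit_val_def)

lemma DERIV_f: "(f has_field_derivative deriv f z) (at z)"
  using holo by (intro holomorphic_derivI[of f UNIV]) auto

lemma real_f_deriv: "(real_f has_real_derivative Re (deriv f (of_real x))) (at x)"
  and deriv_f_real: "deriv f (of_real x) = of_real (Re (deriv f (of_real x)))"
proof -
  have "((\<lambda>t. f (of_real t)) has_vector_derivative deriv f (of_real x)) (at x)"
    using has_vector_derivative_real_field[OF DERIV_f[of "of_real x"]] .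
  then have R: "(real_f has_vector_derivative Re (deriv f (of_real x))) (at x)"
    and I: "((\<lambda>t. Im (f (of_real t))) has_vector_derivative Im (deriv f (of_real x))) (at x)"
    unfolding real_f_def
    by (auto intro: bounded_linear.has_vector_derivative[OF bounded_linear_Re]
        bounded_linear.has_vector_derivative[OF bounded_linear_Im])
  show "(real_f has_real_derivative Re (deriv f (of_real x))) (at x)"
    using R by (simp add: has_real_derivative_iff_has_vector_derivative)
  have "((\<lambda>t. 0::real) has_vector_derivative Im (deriv f (of_real x))) (at x)"
    using I by (simp add: f_of_real)
  then have "Im (deriv f (of_real x)) = 0"
    using vector_derivative_unique_at has_vector_derivative_const by blast
  then show "deriv f (of_real x) = of_real (Re (deriv f (of_real x)))"
    by (simp add: complex_eq_iff)
qed

text \<open>With non-negative coefficients the weighted norm is the value of the series on the real axis.\<close>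

lemma coeff: "fps_nth G n = of_real (cmod (fps_nth G n))"
  using coeff_nonneg[of n] by (auto elim!: nonneg_Reals_cases)

lemma abs_conv_G: "0 \<le> y \<Longrightarrow> ereal y < fps_conv_radius G \<Longrightarrow> abs_conv G y"
  by (rule abs_conv_in_radius)

lemma eval_G_real:
  assumes "0 \<le> y" "ereal y < fps_conv_radius G"
  shows "eval_fps G (of_real y) = of_real (weighted_norm G y)"
proof -
  have "(\<lambda>n. complex_of_real (cmod (fps_nth G n) * y ^ n)) sums of_real (weighted_norm G y)"
    unfolding weighted_norm_def using abs_conv_G[OF assms]
    by (intro sums_of_real summable_sums) (simp add: abs_conv_def)
  then have "(\<lambda>n. fps_nth G n * of_real y ^ n) sums of_real (weighted_norm G y)"
    by (simp add: coeff[symmetric])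
  then show ?thesis by (simp add: eval_fps_def sums_iff)
qed

text \<open>The derivative at \<open>0\<close> is the reciprocal of the first coefficient of \<open>G\<close>.\<close>

lemma deriv_f_pos_at_0: "Re (deriv f 0) > 0"
proof -
  have "(eval_fps G has_field_derivative eval_fps (fps_deriv G) (f 0)) (at (f 0))"
    by (rule has_field_derivative_eval_fps) (use radius f0 in \<open>simp add: zero_ereal_def\<close>)
  then have "((\<lambda>z. eval_fps G (f z)) has_field_derivative eval_fps (fps_deriv G) (f 0) * deriv f 0) (at 0)"
    by (rule DERIV_chain2[OF _ DERIV_f])
  moreover have "((\<lambda>z. eval_fps G (f z)) has_field_derivative 1) (at 0)"
    using DERIV_ident near0 by (subst DERIV_cong_ev[OF refl _ refl, where g = "\<lambda>z. z"]) auto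
  ultimately have "eval_fps (fps_deriv G) (f 0) * deriv f 0 = 1" by (rule DERIV_unique)
  then have "fps_nth G 1 * deriv f 0 = 1" by (simp add: f0 eval_fps_at_0)
  also have "fps_nth G 1 * deriv f 0 = of_real (cmod (fps_nth G 1) * Re (deriv f 0))"
    using coeff[of 1] deriv_f_real[of 0] by (metis of_real_0 of_real_mult)
  finally have "cmod (fps_nth G 1) * Re (deriv f 0) = 1" by (simp only: of_real_eq_1_iff)
  then have "0 < cmod (fps_nth G 1) * Re (deriv f 0)" by simp
  then show ?thesis by (metis norm_ge_zero zero_less_mult_iff not_less)
qed

lemma deriv_fr_pos:
  assumes "0 \<le> x" "x < \<xi>"
  shows "Re (deriv f (of_real x)) > 0"
proof (rule ccontr)
  assume "\<not> ?thesis"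
  then have "Re (deriv f (of_real x)) \<le> 0" by simp
  moreover have "continuous_on UNIV (deriv f)"
    by (rule holomorphic_on_imp_continuous_on[OF holomorphic_deriv[OF holo open_UNIV]])
  then have "continuous_on {0..x} (\<lambda>x. Re (deriv f (of_real x)))"
    by (rule continuous_on_Re[OF continuous_on_compose2]) (auto intro!: continuous_intros)
  ultimately obtain y where "0 \<le> y" "y \<le> x" "Re (deriv f (of_real y)) = 0"
    using IVT2'[of "\<lambda>x. Re (deriv f (of_real x))" x 0 0] deriv_f_pos_at_0 assms by auto
  then show False using no_critical[of y] deriv_f_real[of y] assms by simp
qed

lemma cont_fr: "continuous_on S real_f"
  using real_f_deriv by (meson DERIV_isCont continuous_at_imp_continuous_on)

lemma real_f_strict_mono: "0 \<le> x \<Longrightarrow> x < y \<Longrightarrow> y \<le> \<xi> \<Longrightarrow> real_f x < real_f y"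
  by (rule DERIV_pos_imp_increasing_open[of x y real_f]) (use real_f_deriv deriv_fr_pos cont_fr in force)+

lemma crit_val_pos: "crit_val > 0"
  using real_f_strict_mono[of 0 \<xi>] \<xi>_pos by (simp add: real_f_0 real_f_\<xi>)

lemma real_f_surj:
  assumes "0 \<le> y" "y < crit_val"
  obtains x where "0 \<le> x" "x < \<xi>" "real_f x = y"
proof -
  obtain x where "0 \<le> x" "x \<le> \<xi>" "real_f x = y"
    using IVT'[of real_f 0 y \<xi>] assms cont_fr \<xi>_pos by (auto simp: real_f_0 real_f_\<xi>)
  then show ?thesis using that[of x] assms real_f_\<xi> by (cases "x = \<xi>") auto
qed

text \<open>A radius \<open>R\<close> of convergence below \<open>f \<xi>\<close> would be a value \<open>f b\<close> with \<open>b < \<xi>\<close>. As \<open>f' b \<noteq> 0\<close>, the local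
inverse of \<open>f\<close> at \<open>b\<close> continues the series across \<open>R\<close>, contrary to \<open>vivanti_pringsheim\<close>.\<close>

lemma radius_ge: "fps_conv_radius G \<ge> ereal crit_val"
proof (rule ccontr)
  assume "\<not> ?thesis"
  then obtain R where R: "fps_conv_radius G = ereal R" "0 < R" "R < crit_val"
    using radius by (cases "fps_conv_radius G") auto
  obtain b where b: "0 \<le> b" "b < \<xi>" "real_f b = R" using real_f_surj[of R] R by auto
  have b0: "0 < b" using b R by (cases "b = 0") (auto simp: real_f_0)
  obtain r where r: "r > 0" "inj_on f (ball (of_real b) r)"
    using has_complex_derivative_locally_injective[OF holo UNIV_I open_UNIV no_critical[OF b(1,2)]] by blast
  let ?B = "ball (complex_of_real b) r"
  have hB: "f holomorphic_on ?B" using holo holomorphic_on_subset by blast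
  obtain \<psi> where \<psi>: "\<psi> holomorphic_on f ` ?B" "\<And>z. z \<in> ?B \<Longrightarrow> \<psi> (f z) = z"
    using holomorphic_has_inverse[OF hB open_ball r(2)] by metis
  have oB: "open (f ` ?B)" by (rule open_mapping_thm3[OF hB open_ball r(2)])
  have "of_real R \<in> f ` ?B" using r b f_of_real[of b] by (metis centre_in_ball imageI)
  then obtain \<epsilon> where \<epsilon>: "\<epsilon> > 0" "ball (of_real R) \<epsilon> \<subseteq> f ` ?B"
    using oB open_contains_ball by blast
  let ?W = "ball (complex_of_real R) \<epsilon> \<inter> ball 0 R"
  \<comment> \<open>Continuation along the real axis is available up to points left of \<open>b\<close> only. So take \<open>x < b\<close>
    close enough to \<open>b\<close> that \<open>x\<close> and \<open>f x\<close> lie in the discs on which \<open>\<psi>\<close> is known, and compare there.\<close>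
  have "isCont real_f b" using real_f_deriv DERIV_isCont by blast
  then obtain \<delta> where \<delta>: "\<delta> > 0" "\<And>x. \<bar>x - b\<bar> < \<delta> \<Longrightarrow> \<bar>real_f x - R\<bar> < \<epsilon>"
    using \<epsilon>(1) b(3) unfolding continuous_at_eps_delta by (metis dist_real_def)
  define x where "x = b - min b (min r \<delta>) / 2"
  have x: "0 < x" "x < b" "\<bar>x - b\<bar> < r" "\<bar>x - b\<bar> < \<delta>"
    using b0 r(1) \<delta>(1) by (auto simp: x_def)
  have frx: "0 < real_f x" "real_f x < R"
    using real_f_strict_mono[of 0 x] real_f_strict_mono[of x b] x b by (auto simp: real_f_0)
  let ?K = "complex_of_real ` {0..x}"
  have "cmod (f z) < R" if "z \<in> ?K" for z
  proof -
    obtain u where u: "z = of_real u" "0 \<le> u" "u \<le> x" using \<open>z \<in> ?K\<close> by auto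
    have "0 \<le> real_f u" "real_f u \<le> real_f x"
      using real_f_strict_mono[of 0 u] real_f_strict_mono[of u x] u x b by (auto simp: real_f_0 order_le_less)
    then show ?thesis using frx by (simp add: u f_of_real)
  qed
  moreover have "connected ?K" by (intro connected_continuous_image continuous_intros) auto
  moreover have "0 \<in> ?K" using x by (intro image_eqI[of _ _ 0]) auto
  ultimately obtain U where U: "open U" "?K \<subseteq> U" "\<And>z. z \<in> U \<Longrightarrow> eval_fps G (f z) = z"
      "\<And>z. z \<in> U \<Longrightarrow> cmod (f z) < R"
    using eval_inverse_fps_on_connected[OF holo f0 near0, of ?K] R(1)
    by (metis less_ereal.simps(1))
  let ?N = "f ` (U \<inter> ?B)"
  have xU: "of_real x \<in> U \<inter> ?B" using U(2) x by (auto simp: dist_of_real dist_real_def)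
  have agree: "\<psi> w = eval_fps G w" if "w \<in> ?N" for w
    using that U(3) \<psi>(2) by auto
  have "\<psi> w = eval_fps G w" if w: "w \<in> ?W" for w
  proof (rule analytic_continuation_open[of "?N \<inter> ?W" ?W \<psi> "eval_fps G"])
    show "open (?N \<inter> ?W)"
      using open_mapping_thm3[OF holomorphic_on_subset[OF holo] open_Int[OF U(1) open_ball] inj_on_subset[OF r(2)]]
      by (intro open_Int) auto
    have "f (of_real x) \<in> ?W"
      using \<delta>(2)[OF x(4)] frx by (simp add: f_of_real dist_of_real dist_real_def abs_minus_commute)
    then show "?N \<inter> ?W \<noteq> {}" using xU by blast
    show "connected ?W" by (intro convex_connected convex_Int) auto
    show "\<psi> holomorphic_on ?W" by (rule holomorphic_on_subset[OF \<psi>(1)]) (use \<epsilon> in auto)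
    show "eval_fps G holomorphic_on ?W" by (rule holomorphic_on_eval_fps) (use R in auto)
  qed (use agree w in auto)
  then show False
    by (intro vivanti_pringsheim[OF coeff norm_ge_zero R(1,2) holomorphic_on_subset[OF \<psi>(1) \<epsilon>(2)] \<epsilon>(1)]) auto
qed

lemma weighted_norm_real_f:
  assumes "0 \<le> x" "x < \<xi>"
  shows "weighted_norm G (real_f x) = x" and "abs_conv G (real_f x)"
proof -
  let ?K = "complex_of_real ` {0..x}"
  have *: "0 \<le> real_f u \<and> ereal (real_f u) < fps_conv_radius G" if "0 \<le> u" "u \<le> x" for u
  proof -
    have "0 \<le> real_f u" using real_f_strict_mono[of 0 u] that assms by (cases "u = 0") (auto simp: real_f_0)
    moreover have "ereal (real_f u) < ereal crit_val" using real_f_strict_mono[of u \<xi>] that assms by (simp add: real_f_\<xi>)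
    ultimately show ?thesis using less_le_trans[OF _ radius_ge] by blast
  qed
  have "ereal (cmod (f z)) < fps_conv_radius G" if "z \<in> ?K" for z
    using that * by (auto simp: f_of_real)
  moreover have "connected ?K" by (intro connected_continuous_image continuous_intros) auto
  moreover have "0 \<in> ?K" using assms by (intro image_eqI[of _ _ 0]) auto
  ultimately obtain U where U: "?K \<subseteq> U" "\<And>z. z \<in> U \<Longrightarrow> eval_fps G (f z) = z"
    using eval_inverse_fps_on_connected[OF holo f0 near0, of ?K] by metis
  have "of_real x \<in> U" using U(1) assms by auto
  then have "eval_fps G (f (of_real x)) = of_real x" by (rule U(2))
  then show "weighted_norm G (real_f x) = x"
    using eval_G_real[of "real_f x"] *[of x] assms by (simp add: f_of_real)
  show "abs_conv G (real_f x)" using abs_conv_G *[of x] assms by simp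
qed

text \<open>Convergence at the boundary value itself: each partial sum is at most \<open>x\<close> at \<open>f x\<close> for \<open>x < \<xi>\<close>, and
partial sums are continuous.\<close>

lemma abs_conv_crit_val: "abs_conv G crit_val" and weighted_norm_crit_val: "weighted_norm G crit_val \<le> \<xi>"
proof -
  have le: "(\<Sum>n<N. cmod (fps_nth G n) * crit_val ^ n) \<le> \<xi>" for N
  proof (rule tendsto_upperbound)
    show "((\<lambda>x. \<Sum>n<N. cmod (fps_nth G n) * real_f x ^ n) \<longlongrightarrow> (\<Sum>n<N. cmod (fps_nth G n) * crit_val ^ n)) (at_left \<xi>)"
      unfolding real_f_\<xi>[symmetric] using DERIV_isCont[OF real_f_deriv[of \<xi>]]
      by (intro tendsto_intros) (auto simp: isCont_def intro: filterlim_at_split[THEN iffD1, THEN conjunct1])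
    have "(\<Sum>n<N. cmod (fps_nth G n) * real_f x ^ n) \<le> \<xi>" if "0 < x" "x < \<xi>" for x
    proof -
      have "0 \<le> real_f x" using real_f_strict_mono[of 0 x] that by (simp add: real_f_0)
      then have "(\<Sum>n<N. cmod (fps_nth G n) * real_f x ^ n) \<le> weighted_norm G (real_f x)"
        unfolding weighted_norm_def using weighted_norm_real_f(2)[of x] that
        by (intro sum_le_suminf) (auto simp: abs_conv_def)
      then show ?thesis using weighted_norm_real_f(1)[of x] that by simp
    qed
    then show "\<forall>\<^sub>F x in at_left \<xi>. (\<Sum>n<N. cmod (fps_nth G n) * real_f x ^ n) \<le> \<xi>"
      using eventually_at_left_real[OF \<xi>_pos] by (auto elim: eventually_mono)
  qed simp
  show c: "abs_conv G crit_val"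
    unfolding abs_conv_def using le crit_val_pos by (intro summableI_nonneg_bounded[where x = \<xi>]) auto
  show "weighted_norm G crit_val \<le> \<xi>"
    unfolding weighted_norm_def using c le by (intro suminf_le_const) (auto simp: abs_conv_def)
qed

lemma weighted_norm_less: "0 \<le> y \<Longrightarrow> y < crit_val \<Longrightarrow> weighted_norm G y < \<xi>"
  using real_f_surj[of y] weighted_norm_real_f by metis

text \<open>Where \<open>f\<close> stays in the disc of convergence along the segment from \<open>0\<close>, the germ is still a left
inverse of \<open>f\<close> at the endpoint, which rules out a critical point there.\<close>

lemma deriv_nonzero_on_ray:
  assumes "\<And>s. 0 \<le> s \<Longrightarrow> s \<le> t \<Longrightarrow> cmod (f (of_real s * z)) < crit_val" "0 \<le> t"
  shows "deriv f (of_real t * z) \<noteq> 0"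
proof -
  let ?K = "(\<lambda>s. complex_of_real s * z) ` {0..t}"
  have "ereal (cmod (f z)) < fps_conv_radius G" if "z \<in> ?K" for z
    using that assms(1) less_le_trans[OF _ radius_ge, of "ereal (cmod (f z))"] by fastforce
  moreover have "connected ?K" by (intro connected_continuous_image continuous_intros) auto
  moreover have "0 \<in> ?K" using assms by (intro image_eqI[of _ _ 0]) auto
  ultimately obtain U where U: "open U" "?K \<subseteq> U" "\<And>z. z \<in> U \<Longrightarrow> eval_fps G (f z) = z"
    "\<And>z. z \<in> U \<Longrightarrow> ereal (cmod (f z)) < fps_conv_radius G"
    using eval_inverse_fps_on_connected[OF holo f0 near0, of ?K] by metis
  let ?w = "of_real t * z"
  have w: "?w \<in> U" by (rule subsetD[OF U(2)]) (use assms(2) in auto)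
  have "((\<lambda>z. eval_fps G (f z)) has_field_derivative eval_fps (fps_deriv G) (f ?w) * deriv f ?w) (at ?w)"
    by (rule DERIV_chain2[OF has_field_derivative_eval_fps[OF U(4)[OF w]] DERIV_f])
  moreover have "((\<lambda>z. eval_fps G (f z)) has_field_derivative 1) (at ?w)"
    using has_field_derivative_transform_within_open[OF DERIV_ident U(1) w] U(3) by simp
  ultimately have "eval_fps (fps_deriv G) (f ?w) * deriv f ?w = 1" by (rule DERIV_unique)
  then show ?thesis by auto
qed

end

section \<open>The Banach algebra of complex-linear operators\<close>

lemma scaleR_scaleC_commute:
  fixes x :: "'a::complex_normed_vector"
  shows "r *\<^sub>R c *\<^sub>C x = c *\<^sub>C r *\<^sub>R x"
  by (simp add: scaleC_scaleC mult.commute flip: scaleC_of_real)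

lemma complex_linear_intros:
  fixes A B :: "'a::complex_normed_vector \<Rightarrow>\<^sub>L 'a"
  shows "complex_linear (0 :: 'a \<Rightarrow>\<^sub>L 'a)" "complex_linear (id_blinfun :: 'a \<Rightarrow>\<^sub>L 'a)"
    and "complex_linear A \<Longrightarrow> complex_linear B \<Longrightarrow> complex_linear (A + B)"
    and "complex_linear A \<Longrightarrow> complex_linear B \<Longrightarrow> complex_linear (A - B)"
    and "complex_linear A \<Longrightarrow> complex_linear (- A)"
    and "complex_linear A \<Longrightarrow> complex_linear B \<Longrightarrow> complex_linear (A o\<^sub>L B)"
    and "complex_linear A \<Longrightarrow> complex_linear (r *\<^sub>R A)"
    and "complex_linear A \<Longrightarrow> complex_linear (c *\<^sub>C A)"
  by (auto simp: complex_linear_def blinfun.bilinear_simps scaleC_add_right scaleR_scaleC_commute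
      bounded_bilinear.diff_right[OF bounded_bilinear_scaleC] scaleC_blinfun.rep_eq scaleC_scaleC
      bounded_bilinear.minus_right[OF bounded_bilinear_scaleC] mult.commute)

text \<open>Closedness of the complex-linear maps among the real-linear ones; this gives completeness of the
algebra below.\<close>

lemma complex_linear_limit:
  fixes X :: "nat \<Rightarrow> ('a::complex_normed_vector \<Rightarrow>\<^sub>L 'a)"
  assumes "\<And>n. complex_linear (X n)" "X \<longlonglongrightarrow> L"
  shows "complex_linear L"
  unfolding complex_linear_def
proof (intro allI)
  fix c x
  have "(\<lambda>n. blinfun_apply (X n) (c *\<^sub>C x)) \<longlonglongrightarrow> blinfun_apply L (c *\<^sub>C x)"
    by (intro blinfun.tendsto assms tendsto_const)
  moreover have "(\<lambda>n. c *\<^sub>C blinfun_apply (X n) x) \<longlonglongrightarrow> c *\<^sub>C blinfun_apply L x"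
    by (intro tendsto_scaleC blinfun.tendsto assms tendsto_const)
  ultimately show "blinfun_apply L (c *\<^sub>C x) = c *\<^sub>C blinfun_apply L x"
    using assms(1) by (simp add: complex_linear_def LIMSEQ_unique)
qed

lemma scaleC_compose_left:
  fixes A B :: "'a::complex_normed_vector \<Rightarrow>\<^sub>L 'a"
  shows "(c *\<^sub>C A) o\<^sub>L B = c *\<^sub>C (A o\<^sub>L B)"
  by (rule blinfun_eqI) (simp add: scaleC_blinfun.rep_eq)

lemma scaleC_compose_right:
  fixes A B :: "'a::complex_normed_vector \<Rightarrow>\<^sub>L 'a"
  shows "complex_linear A \<Longrightarrow> A o\<^sub>L (c *\<^sub>C B) = c *\<^sub>C (A o\<^sub>L B)"
  by (rule blinfun_eqI) (simp add: scaleC_blinfun.rep_eq complex_linear_def)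

text \<open>The product algebra of \<open>\<complex>\<close> and the complex-linear bounded operators, with the maximum norm. The extra
factor \<open>\<complex>\<close> ensures \<open>0 \<noteq> 1\<close> and \<open>\<parallel>1\<parallel> = 1\<close> on the zero space too, so that the type is a unital
Banach algebra without any condition on the underlying space. An operator \<open>A\<close> is represented by \<open>(0, A)\<close>;
this adds at most the point \<open>0\<close> to its spectrum and does not affect the norm of \<open>f(A)\<close> when \<open>f 0 = 0\<close>.\<close>

typedef (overloaded) 'a operator_algebra =
  "{p :: complex \<times> ('a::complex_banach \<Rightarrow>\<^sub>L 'a). complex_linear (snd p)}"
  by (rule exI[of _ "(0, 0)"]) (simp add: complex_linear_intros)

definition scalar_part :: "'a::complex_banach operator_algebra \<Rightarrow> complex" where
  "scalar_part x = fst (Rep_operator_algebra x)"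

definition operator_part :: "'a::complex_banach operator_algebra \<Rightarrow> ('a \<Rightarrow>\<^sub>L 'a)" where
  "operator_part x = snd (Rep_operator_algebra x)"

definition scalar_operator :: "complex \<Rightarrow> ('a::complex_banach \<Rightarrow>\<^sub>L 'a) \<Rightarrow> 'a operator_algebra" where
  "scalar_operator c A = Abs_operator_algebra (c, A)"

lemma operator_algebra_eq_iff:
  "x = y \<longleftrightarrow> scalar_part x = scalar_part y \<and> operator_part x = operator_part y"
  by (auto simp: scalar_part_def operator_part_def prod_eq_iff simp flip: Rep_operator_algebra_inject)

lemma complex_linear_operator_part [simp]: "complex_linear (operator_part x)"
  using Rep_operator_algebra[of x] by (simp add: operator_part_def)

lemma scalar_operator_parts [simp]:
  assumes "complex_linear A"
  shows "scalar_part (scalar_operator c A) = c" "operator_part (scalar_operator c A) = A"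
  using assms by (simp_all add: scalar_part_def operator_part_def scalar_operator_def Abs_operator_algebra_inverse)

instantiation operator_algebra :: (complex_banach) "{real_normed_algebra_1, complex_normed_vector}"
begin

definition "0 = (scalar_operator 0 0 :: 'a operator_algebra)"
definition "1 = (scalar_operator 1 id_blinfun :: 'a operator_algebra)"
definition "x + y = (scalar_operator (scalar_part x + scalar_part y) (operator_part x + operator_part y) :: 'a operator_algebra)"
definition "x - y = (scalar_operator (scalar_part x - scalar_part y) (operator_part x - operator_part y) :: 'a operator_algebra)"
definition "- x = (scalar_operator (- scalar_part x) (- operator_part x) :: 'a operator_algebra)"
definition "x * y = (scalar_operator (scalar_part x * scalar_part y) (operator_part x o\<^sub>L operator_part y) :: 'a operator_algebra)"
definition "r *\<^sub>R x = (scalar_operator (r *\<^sub>R scalar_part x) (r *\<^sub>R operator_part x) :: 'a operator_algebra)"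
definition "c *\<^sub>C x = (scalar_operator (c * scalar_part x) (c *\<^sub>C operator_part x) :: 'a operator_algebra)"
definition "norm x = max (cmod (scalar_part x)) (norm (operator_part (x :: 'a operator_algebra)))"
definition "sgn x = inverse (norm x) *\<^sub>R (x :: 'a operator_algebra)"
definition "dist x y = norm (x - y :: 'a operator_algebra)"
definition "uniformity = (INF e\<in>{0<..}. principal {(x, y :: 'a operator_algebra). dist x y < e})"
definition "open U = (\<forall>x\<in>U. eventually (\<lambda>(x', y). x' = x \<longrightarrow> (y :: 'a operator_algebra) \<in> U) uniformity)"

lemma parts_simps [simp]:
  fixes x y :: "'a operator_algebra"
  shows "scalar_part (0 :: 'a operator_algebra) = 0" "operator_part (0 :: 'a operator_algebra) = 0"
    and "scalar_part (1 :: 'a operator_algebra) = 1" "operator_part (1 :: 'a operator_algebra) = id_blinfun"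
    and "scalar_part (x + y) = scalar_part x + scalar_part y"
    and "operator_part (x + y) = operator_part x + operator_part y"
    and "scalar_part (x - y) = scalar_part x - scalar_part y"
    and "operator_part (x - y) = operator_part x - operator_part y"
    and "scalar_part (- x) = - scalar_part x" "operator_part (- x) = - operator_part x"
    and "scalar_part (x * y) = scalar_part x * scalar_part y"
    and "operator_part (x * y) = operator_part x o\<^sub>L operator_part y"
    and "scalar_part (r *\<^sub>R x) = r *\<^sub>R scalar_part x" "operator_part (r *\<^sub>R x) = r *\<^sub>R operator_part x"
    and "scalar_part (c *\<^sub>C x) = c * scalar_part x" "operator_part (c *\<^sub>C x) = c *\<^sub>C operator_part x"
  by (simp_all add: zero_operator_algebra_def one_operator_algebra_def plus_operator_algebra_def
      minus_operator_algebra_def uminus_operator_algebra_def times_operator_algebra_def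
      scaleR_operator_algebra_def scaleC_operator_algebra_def complex_linear_intros)

instance
proof
  fix x y z :: "'a operator_algebra" and r s :: real and c d :: complex and U :: "'a operator_algebra set"
  note bil = bounded_bilinear.add_left[OF bounded_bilinear_blinfun_compose]
    bounded_bilinear.add_right[OF bounded_bilinear_blinfun_compose]
    bounded_bilinear.scaleR_left[OF bounded_bilinear_blinfun_compose]
    bounded_bilinear.scaleR_right[OF bounded_bilinear_blinfun_compose]
  note eq = operator_algebra_eq_iff
  show "x + y + z = x + (y + z)" by (simp add: eq add.assoc)
  show "x + y = y + x" by (simp add: eq add.commute)
  show "0 + x = x" by (simp add: eq)
  show "- x + x = 0" by (simp add: eq)
  show "x - y = x + - y" by (simp add: eq)
  show "x * y * z = x * (y * z)" by (simp add: eq blinfun_eqI)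
  show "1 * x = x" "x * 1 = x" by (simp_all add: eq blinfun_eqI)
  show "(x + y) * z = x * z + y * z" by (simp add: eq bil distrib_right)
  show "x * (y + z) = x * y + x * z" by (simp add: eq bil distrib_left)
  show "0 \<noteq> (1 :: 'a operator_algebra)" by (simp add: eq)
  show "r *\<^sub>R (x + y) = r *\<^sub>R x + r *\<^sub>R y" by (simp add: eq scaleR_add_right distrib_left)
  show "(r + s) *\<^sub>R x = r *\<^sub>R x + s *\<^sub>R x" by (simp add: eq scaleR_add_left distrib_right)
  show "r *\<^sub>R s *\<^sub>R x = (r * s) *\<^sub>R x" by (simp add: eq)
  show "1 *\<^sub>R x = x" by (simp add: eq)
  show "r *\<^sub>R x * y = r *\<^sub>R (x * y)" by (simp add: eq bil)
  show "x * r *\<^sub>R y = r *\<^sub>R (x * y)" by (simp add: eq bil)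
  show "complex_of_real r *\<^sub>C x = r *\<^sub>R x" by (simp add: eq scaleC_of_real scaleR_conv_of_real)
  show "c *\<^sub>C (x + y) = c *\<^sub>C x + c *\<^sub>C y" by (simp add: eq scaleC_add_right distrib_left)
  show "(c + d) *\<^sub>C x = c *\<^sub>C x + d *\<^sub>C x" by (simp add: eq scaleC_add_left distrib_right)
  show "c *\<^sub>C d *\<^sub>C x = (c * d) *\<^sub>C x" by (simp add: eq scaleC_scaleC)
  show "norm (c *\<^sub>C x) = cmod c * norm x"
    by (simp add: norm_operator_algebra_def norm_mult norm_scaleC max_mult_distrib_left)
  show "norm x = 0 \<longleftrightarrow> x = 0"
    by (auto simp: eq norm_operator_algebra_def max_def)
  show "norm (x + y) \<le> norm x + norm y"
    unfolding norm_operator_algebra_def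
    by (auto intro!: order_trans[OF norm_triangle_ineq] add_mono)
  show "norm (r *\<^sub>R x) = \<bar>r\<bar> * norm x" by (simp add: norm_operator_algebra_def norm_mult max_mult_distrib_left)
  show "norm (x * y) \<le> norm x * norm y"
    unfolding norm_operator_algebra_def
    by (auto simp: norm_mult le_max_iff_disj intro!: mult_mono order_trans[OF norm_blinfun_compose])
  show "norm (1 :: 'a operator_algebra) = 1"
    unfolding norm_operator_algebra_def by (simp add: max_absorb1[OF norm_blinfun_id_le])
  show "sgn x = inverse (norm x) *\<^sub>R x" by (rule sgn_operator_algebra_def)
  show "dist x y = norm (x - y)" by (rule dist_operator_algebra_def)
  show "uniformity = (INF e\<in>{0<..}. principal {(x, y :: 'a operator_algebra). dist x y < e})"
    by (rule uniformity_operator_algebra_def)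
  show "open U = (\<forall>x\<in>U. eventually (\<lambda>(x', y). x' = x \<longrightarrow> y \<in> U) uniformity)"
    by (rule open_operator_algebra_def)
qed

end

instance operator_algebra :: (complex_banach) complex_banach_algebra_1
proof
  fix x y :: "'a operator_algebra" and c :: complex
  show "(c *\<^sub>C x) * y = c *\<^sub>C (x * y)" by (simp add: operator_algebra_eq_iff scaleC_compose_left)
  show "x * (c *\<^sub>C y) = c *\<^sub>C (x * y)" by (simp add: operator_algebra_eq_iff scaleC_compose_right)
next
  fix X :: "nat \<Rightarrow> 'a operator_algebra"
  assume X: "Cauchy X"
  have dist: "dist x y = max (dist (scalar_part x) (scalar_part y)) (dist (operator_part x) (operator_part y))"
    for x y :: "'a operator_algebra"
    by (simp add: dist_operator_algebra_def norm_operator_algebra_def dist_norm)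
  have "Cauchy (\<lambda>n. scalar_part (X n))" "Cauchy (\<lambda>n. operator_part (X n))"
    using X unfolding Cauchy_def dist max_less_iff_conj by meson+
  then obtain l L where l: "(\<lambda>n. scalar_part (X n)) \<longlonglongrightarrow> l" and L: "(\<lambda>n. operator_part (X n)) \<longlonglongrightarrow> L"
    using Cauchy_convergent convergent_def by metis
  have lin: "complex_linear L" by (rule complex_linear_limit[OF complex_linear_operator_part L])
  define y where "y = scalar_operator l L"
  have y: "scalar_part y = l" "operator_part y = L" using lin by (simp_all add: y_def)
  have "(\<lambda>n. dist (X n) y) \<longlonglongrightarrow> max 0 0"
    unfolding dist y by (intro tendsto_max l[THEN tendsto_dist_iff[THEN iffD1]] L[THEN tendsto_dist_iff[THEN iffD1]])
  then have "\<forall>e>0. \<exists>N. \<forall>n\<ge>N. dist (X n) y < e"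
    by (auto simp: LIMSEQ_def dist_real_def dist_operator_algebra_def)
  then show "convergent X"
    unfolding convergent_def lim_sequentially by blast
qed

section \<open>The holomorphic calculus as a power series\<close>

text \<open>The resolvent is the Neumann series, uniformly convergent on the circle, so the contour integral may
be taken term by term. Each term is Cauchy's formula for a Taylor coefficient of \<open>f\<close>.\<close>

theorem riesz_dunford_power_series:
  fixes a :: "'a::complex_banach_algebra_1"
  assumes f: "f holomorphic_on UNIV" and r: "norm a < r"
  defines "\<gamma> \<equiv> circlepath 0 r"
  shows "((\<lambda>s. (f (\<gamma> s) * vector_derivative \<gamma> (at s within {0..1})) *\<^sub>C
            fps_apply (Abs_fps (\<lambda>n. inverse (\<gamma> s) ^ Suc n)) a)
    has_integral ((2 * of_real pi * \<i>) *\<^sub>C fps_apply (fps_expansion f 0) a)) {0..1}"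
proof -
  let ?I = "{0..1::real}"
  let ?F = "fps_expansion f 0"
  have r0: "0 < r" using r norm_ge_zero[of a] by linarith
  define w where "w s = 2 * of_real pi * \<i> * r * exp (2 * of_real pi * \<i> * of_real s)" for s :: real
  have vd: "vector_derivative \<gamma> (at s within ?I) = w s" if "s \<in> ?I" for s
    using that unfolding \<gamma>_def w_def by (subst vector_derivative_circlepath01) auto
  have \<gamma>: "cmod (\<gamma> s) = r" for s
    using r0 by (simp add: \<gamma>_def circlepath norm_mult)
  have \<gamma>0: "\<gamma> s \<noteq> 0" for s using \<gamma>[of s] r0 by auto
  have cont_\<gamma>: "continuous_on ?I \<gamma>" unfolding \<gamma>_def circlepath by (intro continuous_intros)
  have cont_f: "continuous_on ?I (\<lambda>s. f (\<gamma> s))"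
    by (rule continuous_on_compose2[OF holomorphic_on_imp_continuous_on[OF f] cont_\<gamma>]) simp
  define k where "k s = f (\<gamma> s) * w s" for s
  have cont_k: "continuous_on ?I k" unfolding k_def w_def by (intro continuous_intros cont_f)
  have "bounded (k ` ?I)"
    by (rule compact_imp_bounded[OF compact_continuous_image[OF cont_k compact_Icc]])
  then obtain C where "\<forall>x\<in>k ` ?I. cmod x \<le> C" unfolding bounded_iff by blast
  then have C: "\<And>s. s \<in> ?I \<Longrightarrow> cmod (k s) \<le> C" by blast
  have C0: "0 \<le> C" using order_trans[OF norm_ge_zero C[of 0]] by simp
  define T where "T n s = (k s * inverse (\<gamma> s) ^ Suc n) *\<^sub>C a ^ n" for n s
  have cont_T: "continuous_on ?I (T n)" for n
    unfolding T_def using \<gamma>0 by (intro continuous_intros cont_k cont_\<gamma>) auto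
  have T_int: "(T n has_integral ((2 * of_real pi * \<i>) * fps_nth ?F n) *\<^sub>C a ^ n) ?I" for n
  proof -
    have "((\<lambda>u. f u / (u - 0) ^ Suc n) has_contour_integral
        (2 * pi * \<i>) / (fact n) * (deriv ^^ n) f 0) \<gamma>"
      unfolding \<gamma>_def
      using f r0 by (intro Cauchy_has_contour_integral_higher_derivative_circlepath)
        (auto intro: holomorphic_on_subset holomorphic_on_imp_continuous_on continuous_on_subset)
    then have "((\<lambda>s. f (\<gamma> s) / (\<gamma> s) ^ Suc n * vector_derivative \<gamma> (at s within ?I)) has_integral
        (2 * of_real pi * \<i>) * fps_nth ?F n) ?I"
      by (simp add: has_contour_integral_def fps_expansion_def del: power_Suc)
    then have "((\<lambda>s. k s * inverse (\<gamma> s) ^ Suc n) has_integral (2 * of_real pi * \<i>) * fps_nth ?F n) ?I"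
      by (rule has_integral_eq[rotated]) (simp add: vd k_def divide_inverse power_inverse del: power_Suc)
    then show ?thesis
      unfolding T_def
      by (rule has_integral_linear[OF _ bounded_bilinear.bounded_linear_left[OF bounded_bilinear_scaleC], unfolded o_def])
  qed
  have S: "summable (\<lambda>n. C * inverse r * (norm a / r) ^ n)"
    using r r0 by (intro summable_mult summable_geometric) auto
  have "norm (T n s) \<le> C * inverse r * (norm a / r) ^ n" if "s \<in> ?I" for n s
  proof -
    have "norm (T n s) = cmod (k s) * inverse r ^ Suc n * norm (a ^ n)"
      by (simp add: T_def norm_scaleC norm_mult norm_power norm_inverse \<gamma>)
    also have "\<dots> \<le> C * inverse r ^ Suc n * norm a ^ n"
      using C[OF that] C0 r0 by (intro mult_mono norm_power_ineq) auto
    also have "\<dots> = C * inverse r * (norm a / r) ^ n"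
      by (simp add: divide_inverse power_mult_distrib mult_ac)
    finally show ?thesis .
  qed
  then have "uniform_limit ?I (\<lambda>N s. \<Sum>n<N. T n s) (\<lambda>s. \<Sum>n. T n s) sequentially"
    by (rule Weierstrass_m_test[OF _ S])
  then obtain I J where IJ: "\<And>N. ((\<lambda>s. \<Sum>n<N. T n s) has_integral I N) ?I"
      "((\<lambda>s. \<Sum>n. T n s) has_integral J) ?I" "I \<longlonglongrightarrow> J"
    by (rule uniform_limit_integral) (auto intro!: continuous_intros cont_T)
  have "((\<lambda>s. \<Sum>n<N. T n s) has_integral (\<Sum>n<N. ((2 * of_real pi * \<i>) * fps_nth ?F n) *\<^sub>C a ^ n)) ?I" for N
    by (intro has_integral_sum T_int) auto
  then have "I = (\<lambda>N. \<Sum>n<N. ((2 * of_real pi * \<i>) * fps_nth ?F n) *\<^sub>C a ^ n)"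
    using has_integral_unique[OF IJ(1)] by auto
  moreover have "(\<lambda>n. ((2 * of_real pi * \<i>) * fps_nth ?F n) *\<^sub>C a ^ n) sums ((2 * of_real pi * \<i>) *\<^sub>C fps_apply ?F a)"
  proof -
    have "abs_conv ?F (norm a)"
      using conv_radius_fps_expansion[of f 0 \<infinity>] f by (intro abs_conv_in_radius) auto
    from bounded_linear.sums[OF bounded_linear_scaleC fps_apply_sums[OF this]]
    show ?thesis by (simp add: scaleC_scaleC)
  qed
  ultimately have J: "J = (2 * of_real pi * \<i>) *\<^sub>C fps_apply ?F a"
    using IJ(3) LIMSEQ_unique unfolding sums_def by blast
  have "(\<Sum>n. T n s) = (f (\<gamma> s) * vector_derivative \<gamma> (at s within ?I)) *\<^sub>C
      fps_apply (Abs_fps (\<lambda>n. inverse (\<gamma> s) ^ Suc n)) a" if s: "s \<in> ?I" for s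
  proof -
    have "abs_conv (Abs_fps (\<lambda>n. inverse (\<gamma> s) ^ Suc n)) (norm a)"
      using neumann_series(1)[of a "\<gamma> s"] \<gamma> r by simp
    from bounded_linear.sums[OF bounded_linear_scaleC fps_apply_sums[OF this], of "k s"]
    have "(\<lambda>n. T n s) sums (k s *\<^sub>C fps_apply (Abs_fps (\<lambda>n. inverse (\<gamma> s) ^ Suc n)) a)"
      by (simp add: scaleC_scaleC T_def del: power_Suc)
    then show ?thesis using vd[OF s] by (simp add: sums_iff k_def)
  qed
  then show ?thesis using IJ(2) unfolding J by (rule has_integral_eq)
qed

abbreviation embed_operator :: "('a::complex_banach \<Rightarrow>\<^sub>L 'a) \<Rightarrow> 'a operator_algebra" where
  "embed_operator A \<equiv> scalar_operator 0 A"

lemma norm_embed_operator: "complex_linear A \<Longrightarrow> norm (embed_operator A) = norm A"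
  by (simp add: norm_operator_algebra_def)

lemma embed_operator_scaleR: "complex_linear A \<Longrightarrow> embed_operator (r *\<^sub>R A) = r *\<^sub>R embed_operator A"
  by (simp add: operator_algebra_eq_iff complex_linear_intros)

lemma bounded_linear_operator_part: "bounded_linear operator_part"
  by (rule bounded_linear_intro[of _ 1]) (simp_all add: norm_operator_algebra_def)

lemma bounded_linear_scalar_part: "bounded_linear scalar_part"
  by (rule bounded_linear_intro[of _ 1]) (simp_all add: norm_operator_algebra_def)

lemma resolvent_eqI:
  assumes "is_resolvent_at A z B"
  shows "resolvent A z = B"
  unfolding resolvent_def
proof (rule the_equality)
  show "is_resolvent_at A z B" by (rule assms)
  fix C assume C: "is_resolvent_at A z C"
  let ?D = "z *\<^sub>C id_blinfun - A"
  have "C = C o\<^sub>L (?D o\<^sub>L B)" using assms by (simp add: is_resolvent_at_def blinfun_eqI)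
  also have "\<dots> = (C o\<^sub>L ?D) o\<^sub>L B" by (simp add: blinfun_eqI)
  also have "\<dots> = B" using C by (simp add: is_resolvent_at_def blinfun_eqI)
  finally show "C = B" .
qed

lemma is_resolvent_at_operator_part:
  assumes "complex_linear A" "(z *\<^sub>C 1 - embed_operator A) * x = 1" "x * (z *\<^sub>C 1 - embed_operator A) = 1"
  shows "is_resolvent_at A z (operator_part x)"
  unfolding is_resolvent_at_def
  using assms(1) arg_cong[OF assms(2), of operator_part] arg_cong[OF assms(3), of operator_part]
  by simp

theorem holomorphic_calculus_eq_fps_apply:
  assumes f: "f holomorphic_on UNIV" and A: "complex_linear A"
  shows "holomorphic_calculus f A = operator_part (fps_apply (fps_expansion f 0) (embed_operator A))"
proof -
  let ?\<gamma> = "circlepath 0 (norm A + 1)" and ?a = "embed_operator A"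
  let ?R = "\<lambda>s. fps_apply (Abs_fps (\<lambda>n. inverse (?\<gamma> s) ^ Suc n)) ?a"
  have \<gamma>: "cmod (?\<gamma> s) = norm A + 1" for s
    by (simp add: circlepath norm_mult flip: of_real_add) 
  have res: "resolvent A (?\<gamma> s) = operator_part (?R s)" for s
    using neumann_series(2,3)[of ?a "?\<gamma> s"]
    by (intro resolvent_eqI is_resolvent_at_operator_part A) (auto simp: \<gamma> norm_embed_operator A)
  have "((\<lambda>s. operator_part ((f (?\<gamma> s) * vector_derivative ?\<gamma> (at s within {0..1})) *\<^sub>C ?R s))
      has_integral operator_part ((2 * of_real pi * \<i>) *\<^sub>C fps_apply (fps_expansion f 0) ?a)) {0..1}"
    by (rule has_integral_linear[OF riesz_dunford_power_series[OF f] bounded_linear_operator_part, unfolded o_def])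
       (simp add: norm_embed_operator A)
  then have "((\<lambda>s. (f (?\<gamma> s) * vector_derivative ?\<gamma> (at s within {0..1})) *\<^sub>C resolvent A (?\<gamma> s))
      has_integral (2 * of_real pi * \<i>) *\<^sub>C operator_part (fps_apply (fps_expansion f 0) ?a)) {0..1}"
    by (simp add: res)
  then show ?thesis
    unfolding holomorphic_calculus_def Let_def by (simp add: integral_unique scaleC_scaleC)
qed

lemma norm_fps_apply_embed_operator:
  assumes f: "f holomorphic_on UNIV" "f 0 = 0" and A: "complex_linear A"
  shows "norm (fps_apply (fps_expansion f 0) (embed_operator A)) = norm (holomorphic_calculus f A)"
proof -
  let ?a = "embed_operator A" and ?F = "fps_expansion f 0"
  have "abs_conv ?F (norm ?a)"
    using conv_radius_fps_expansion[of f 0 \<infinity>] f by (intro abs_conv_in_radius) auto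
  then have "(\<lambda>n. scalar_part (fps_nth ?F n *\<^sub>C ?a ^ n)) sums scalar_part (fps_apply ?F ?a)"
    by (intro bounded_linear.sums[OF bounded_linear_scalar_part] fps_apply_sums)
  moreover have "scalar_part (fps_nth ?F n *\<^sub>C ?a ^ n) = 0" for n
    using f(2) A by (cases n) (simp_all add: fps_expansion_def)
  ultimately have "(\<lambda>n. 0) sums scalar_part (fps_apply ?F ?a)" by (simp only:)
  then have "scalar_part (fps_apply ?F ?a) = 0" by (rule sums_unique2[OF _ sums_zero])
  then show ?thesis
    using holomorphic_calculus_eq_fps_apply[OF f(1) A] by (simp add: norm_operator_algebra_def)
qed

text \<open>Away from \<open>0\<close> the scalar coordinate of \<open>z - (0, A)\<close> is invertible, so only the operator coordinate
decides.\<close>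

lemma algebra_spectrum_embed_operator:
  assumes A: "complex_linear A"
  shows "spectrum A \<subseteq> algebra_spectrum (embed_operator A)"
    and "algebra_spectrum (embed_operator A) \<subseteq> insert 0 (spectrum A)"
proof -
  show "spectrum A \<subseteq> algebra_spectrum (embed_operator A)"
    using is_resolvent_at_operator_part[OF A]
    by (fastforce simp: spectrum_def algebra_spectrum_def invertible_element_def)
  show "algebra_spectrum (embed_operator A) \<subseteq> insert 0 (spectrum A)"
  proof (rule subsetI, rule ccontr)
    fix z assume z: "z \<in> algebra_spectrum (embed_operator A)" "z \<notin> insert 0 (spectrum A)"
    then obtain B where B: "is_resolvent_at A z B" and "z \<noteq> 0" by (auto simp: spectrum_def)
    let ?x = "scalar_operator (inverse z) B"
    have "complex_linear B" using B by (simp add: is_resolvent_at_def)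
    then have "(z *\<^sub>C 1 - embed_operator A) * ?x = 1" "?x * (z *\<^sub>C 1 - embed_operator A) = 1"
      using B \<open>z \<noteq> 0\<close> A by (simp_all add: operator_algebra_eq_iff is_resolvent_at_def)
    then show False using z(1) by (auto simp: algebra_spectrum_def invertible_element_def)
  qed
qed

section \<open>Operators with bounded orbit\<close>

text \<open>Both one-sided identities of the germ enter: \<open>\<phi>(f z) = z\<close> near \<open>0\<close> feeds the continuation argument,
and \<open>f(\<phi> w) = w\<close> becomes the formal identity needed for operators.\<close>

lemma class_P_positive_inverse_germ:
  assumes "class_P f" and \<xi>: "\<xi> > 0" and least: "\<And>x::real. x > 0 \<Longrightarrow> deriv f (of_real x) = 0 \<Longrightarrow> \<xi> \<le> x"
  obtains G where "positive_inverse_germ f G \<xi>" "fps_expansion f 0 oo G = fps_X"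
proof -
  obtain \<phi> where f: "f holomorphic_on UNIV" "f 0 = 0" "deriv f 0 \<noteq> 0" "\<And>x::real. f (of_real x) \<in> \<real>"
    and \<phi>: "local_inverse_at_0 f \<phi>" "\<And>n. n \<ge> 1 \<Longrightarrow> (deriv ^^ n) \<phi> 0 \<in> \<real>\<^sub>\<ge>\<^sub>0"
    using assms(1) unfolding class_P_def by blast
  then have \<phi>a: "\<phi> analytic_on {0}" and \<phi>0: "\<phi> 0 = 0"
    and f\<phi>: "\<forall>\<^sub>F w in nhds 0. f (\<phi> w) = w" and \<phi>f: "\<forall>\<^sub>F z in nhds 0. \<phi> (f z) = z"
    by (auto simp: local_inverse_at_0_def)
  define G where "G = fps_expansion \<phi> 0"
  have G: "\<phi> has_fps_expansion G"
    unfolding G_def by (rule analytic_at_imp_has_fps_expansion_0[OF \<phi>a])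
  have F: "f has_fps_expansion fps_expansion f 0"
    using f by (intro has_fps_expansion_fps_expansion[of UNIV]) auto
  have G0: "fps_nth G 0 = 0" using \<phi>0 by (simp add: G_def fps_expansion_def)
  have "fps_nth G n \<in> \<real>\<^sub>\<ge>\<^sub>0" for n
  proof (cases "n = 0")
    case False
    then have "(deriv ^^ n) \<phi> 0 \<in> \<real>\<^sub>\<ge>\<^sub>0" using \<phi>(2)[of n] by simp
    then obtain r where "(deriv ^^ n) \<phi> 0 = complex_of_real r" "r \<ge> 0" by (auto elim: nonneg_Reals_cases)
    then have "fps_nth G n = complex_of_real (r / fact n)" by (simp add: G_def fps_expansion_def)
    then show ?thesis using \<open>r \<ge> 0\<close> by (simp only: nonneg_Reals_of_real_iff) simp
  qed (simp add: G0)
  moreover have "\<forall>\<^sub>F z in nhds 0. eval_fps G (f z) = z"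
  proof -
    have "isCont f 0"
      using holomorphic_on_imp_continuous_on[OF f(1)] by (simp add: continuous_on_eq_continuous_at)
    then have "filterlim f (nhds 0) (nhds 0)" 
      using tendsto_at_iff_tendsto_nhds[of f 0] f(2) by (simp add: isCont_def)
    moreover have "\<forall>\<^sub>F w in nhds 0. eval_fps G w = \<phi> w" using G by (simp add: has_fps_expansion_def)
    ultimately have "\<forall>\<^sub>F z in nhds 0. eval_fps G (f z) = \<phi> (f z)"
      by (rule eventually_compose_filterlim[rotated])
    with \<phi>f show ?thesis by eventually_elim simp
  qed
  moreover have "deriv f (of_real x) \<noteq> 0" if "0 \<le> x" "x < \<xi>" for x :: real
    using that f(3) least[of x] by (cases "x = 0") auto
  moreover have "fps_conv_radius G > 0" using G by (simp add: has_fps_expansion_def)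
  ultimately have "positive_inverse_germ f G \<xi>"
    using f \<xi> G0 by unfold_locales auto
  moreover have "fps_expansion f 0 oo G = fps_X"
  proof (rule fps_expansion_unique_complex)
    show "(f \<circ> \<phi>) has_fps_expansion (fps_expansion f 0 oo G)"
      by (rule has_fps_expansion_compose[OF F G G0])
    show "(f \<circ> \<phi>) has_fps_expansion fps_X"
      using f\<phi> by (subst has_fps_expansion_cong[of _ "\<lambda>w. w", OF _ refl]) (auto intro: has_fps_expansion_fps_X)
  qed
  ultimately show ?thesis by (rule that)
qed

text \<open>Boundedness of \<open>f(t a)\<close> bounds \<open>f\<close> along the ray through every spectral point, so the alternative
in which \<open>f\<close> exceeds \<open>f \<xi>\<close> on that ray cannot occur. The other one makes \<open>f'\<close> nonzero on the
ray up to modulus \<open>\<xi>\<close>.\<close>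

lemma norm_le_spectrum_bound:
  fixes a :: "'a::complex_banach_algebra_1"
  assumes germ: "positive_inverse_germ f G \<xi>" and FG: "fps_expansion f 0 oo G = fps_X"
    and rays: "\<And>\<theta>::real. - pi < \<theta> \<Longrightarrow> \<theta> \<le> pi \<Longrightarrow>
           (\<exists>t>0. cmod (f (of_real t * cis \<theta>)) > Re (f (of_real \<xi>))) \<or>
           (\<forall>t::real. 0 < t \<and> t < \<xi> \<longrightarrow> cmod (f (of_real t * cis \<theta>)) < Re (f (of_real \<xi>)))"
    and bound: "\<And>t. t > 0 \<Longrightarrow> norm (fps_apply (fps_expansion f 0) (t *\<^sub>R a)) \<le> N"
    and N: "N \<le> Re (f (of_real \<xi>))"
    and r: "\<And>z. z \<in> algebra_spectrum a \<Longrightarrow> cmod z \<le> r" and T: "0 < T" "T * r < \<xi>"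
  shows "T * norm a \<le> weighted_norm G N"
proof -
  interpret positive_inverse_germ f G \<xi> by (rule germ)
  let ?F = "fps_expansion f 0"
  have F: "fps_conv_radius ?F = \<infinity>" using conv_radius_fps_expansion[of f 0 \<infinity>] holo by simp
  have eval: "eval_fps ?F z = f z" for z
    using eval_fps_expansion'[of f 0 \<infinity> z] holo by simp
  have N0: "0 \<le> N" using order_trans[OF norm_ge_zero bound[of 1]] by simp
  have orbit: "cmod (f (of_real u * z)) \<le> N" if z: "z \<in> algebra_spectrum a" and u: "u > 0" for z u
  proof -
    have "z / of_real (1 / u) \<in> algebra_spectrum (u *\<^sub>R a)"
      by (rule mem_algebra_spectrum_scaleR) (use z u in auto)
    then have "of_real u * z \<in> algebra_spectrum (u *\<^sub>R a)" by (simp add: mult.commute)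
    from norm_apply_ge_on_spectrum[OF F this] show ?thesis using bound[OF u] by (simp add: eval)
  qed
  have "deriv f (of_real t * z) \<noteq> 0" if t: "0 < t" "t \<le> T" and z: "z \<in> algebra_spectrum a" for t z
  proof (rule deriv_nonzero_on_ray)
    fix s assume s: "0 \<le> s" "s \<le> t"
    show "cmod (f (of_real s * z)) < crit_val"
    proof (cases "s = 0 \<or> z = 0")
      case True
      then show ?thesis using crit_val_pos f0 by auto
    next
      case False
      then have s0: "s > 0" and z0: "cmod z > 0" using s by auto
      have zcis: "z = of_real (cmod z) * cis (Arg z)" by (metis rcis_cmod_Arg rcis_def)
      have "\<not> (\<exists>t>0. cmod (f (of_real t * cis (Arg z))) > crit_val)"
      proof
        assume "\<exists>t>0. cmod (f (of_real t * cis (Arg z))) > crit_val"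
        then obtain u where u: "u > 0" "cmod (f (of_real u * cis (Arg z))) > crit_val" by blast
        have "of_real u * cis (Arg z) = of_real (u / cmod z) * z"
          using z0 by (subst (3) zcis) simp
        then show False using orbit[OF z, of "u / cmod z"] u z0 N by (simp add: crit_val_def)
      qed
      then have ray: "\<And>t. 0 < t \<Longrightarrow> t < \<xi> \<Longrightarrow> cmod (f (of_real t * cis (Arg z))) < crit_val"
        using rays[of "Arg z"] Arg_bounded[of z] by (auto simp: crit_val_def)
      have "s * cmod z \<le> T * r" using r[OF z] s t by (intro mult_mono) auto
      then have "cmod (f (of_real (s * cmod z) * cis (Arg z))) < crit_val"
        using s0 z0 T by (intro ray) auto
      moreover have "of_real (s * cmod z) * cis (Arg z) = of_real s * z"
        by (subst (3) zcis) simp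
      ultimately show ?thesis by (simp only:)
    qed
  qed (use t in simp)
  then show ?thesis
    using deriv_f_pos_at_0 abs_conv_mono[OF abs_conv_crit_val N0] N
    by (intro norm_le_of_bounded_ray[OF holo f0 _ _ coeff0 FG bound _ T(1)]) (auto simp: crit_val_def)
qed

theorem theorem4p11:
  fixes f :: "complex \<Rightarrow> complex" and \<xi> :: real
    and A :: "'a::complex_banach \<Rightarrow>\<^sub>L 'a"
  assumes "class_P f" and "admissible f"
    and "\<xi> > 0" and "deriv f (of_real \<xi>) = 0"
    and "\<And>x::real. x > 0 \<Longrightarrow> deriv f (of_real x) = 0 \<Longrightarrow> \<xi> \<le> x"
    and "\<And>\<theta>::real. - pi < \<theta> \<Longrightarrow> \<theta> \<le> pi \<Longrightarrow>
           (SUP t\<in>{0::real<..}. ereal (cmod (f (of_real t * cis \<theta>)))) > ereal (Re (f (of_real \<xi>))) \<or>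
           (\<forall>t::real. 0 < t \<and> t < \<xi> \<longrightarrow> cmod (f (of_real t * cis \<theta>)) < Re (f (of_real \<xi>)))"
    and "complex_linear A"
    and "(SUP t\<in>{0::real<..}. ereal (norm (holomorphic_calculus f (t *\<^sub>R A)))) \<le> ereal (Re (f (of_real \<xi>)))"
  shows "spectral_radius A = norm A
    \<and> (quasi_nilpotent A \<longrightarrow> A = 0)
    \<and> ((SUP t\<in>{0::real<..}. ereal (norm (holomorphic_calculus f (t *\<^sub>R A)))) < ereal (Re (f (of_real \<xi>))) \<longrightarrow> A = 0)"
proof -
  obtain G where germ: "positive_inverse_germ f G \<xi>" and FG: "fps_expansion f 0 oo G = fps_X"
    using class_P_positive_inverse_germ[OF assms(1,3,5)] by blast
  interpret positive_inverse_germ f G \<xi> by (rule germ)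
  let ?S = "SUP t\<in>{0::real<..}. ereal (norm (holomorphic_calculus f (t *\<^sub>R A)))"
  let ?a = "embed_operator A"
  define r where "r = spectral_radius A"
  note A = assms(7)
  have na: "norm ?a = norm A" by (rule norm_embed_operator[OF A])
  have le: "cmod z \<le> norm A" if "z \<in> insert 0 (spectrum A)" for z
    using norm_le_of_mem_algebra_spectrum[of z ?a] algebra_spectrum_embed_operator(1)[OF A] that na by auto
  then have bdd: "bdd_above (cmod ` insert 0 (spectrum A))" by (intro bdd_aboveI2)
  have r: "cmod z \<le> r" if "z \<in> insert 0 (spectrum A)" for z
    unfolding r_def spectral_radius_def by (rule cSUP_upper[OF that bdd])
  have r0: "0 \<le> r" using r[of 0] by simp
  have r_le: "r \<le> norm A"
    unfolding r_def spectral_radius_def by (rule cSUP_least) (use le in auto)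
  have rays: "(\<exists>t>0. cmod (f (of_real t * cis \<theta>)) > Re (f (of_real \<xi>))) \<or>
           (\<forall>t::real. 0 < t \<and> t < \<xi> \<longrightarrow> cmod (f (of_real t * cis \<theta>)) < Re (f (of_real \<xi>)))"
    if "- pi < \<theta>" "\<theta> \<le> pi" for \<theta> :: real
    using assms(6)[OF that] by (auto simp: less_SUP_iff)
  \<comment> \<open>The bound \<open>N\<close> stays variable: the equality of norm and radius uses \<open>N = f \<xi>\<close>, the strict case
    uses the supremum itself.\<close>
  have key: "T * norm A \<le> weighted_norm G N"
    if S: "?S \<le> ereal N" and N: "N \<le> crit_val" and T: "0 < T" "T * r < \<xi>" for N T
  proof -
    have "norm (fps_apply (fps_expansion f 0) (t *\<^sub>R ?a)) \<le> N" if "t > 0" for t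
    proof -
      have "ereal (norm (holomorphic_calculus f (t *\<^sub>R A))) \<le> ?S"
        by (rule SUP_upper) (use that in simp)
      also note S
      finally show ?thesis
        using norm_fps_apply_embed_operator[OF holo f0 complex_linear_intros(7)[OF A], of t]
        by (simp add: embed_operator_scaleR A)
    qed
    then have "T * norm ?a \<le> weighted_norm G N"
      using algebra_spectrum_embed_operator(2)[OF A] r N
      by (intro norm_le_spectrum_bound[OF germ FG rays _ _ _ T]) (auto simp: crit_val_def)
    then show ?thesis by (simp only: na)
  qed
  \<comment> \<open>Let \<open>T r\<close> tend to \<open>\<xi>\<close>; for \<open>r = 0\<close> every \<open>T\<close> is available and \<open>A\<close> must vanish.\<close>
  have bound: "norm A * \<xi> \<le> r * C" if C: "\<And>T. 0 < T \<Longrightarrow> T * r < \<xi> \<Longrightarrow> T * norm A \<le> C" for C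
  proof (cases "r = 0")
    case True
    have "norm A = 0"
    proof (rule ccontr)
      assume "norm A \<noteq> 0"
      then have "0 < (\<bar>C\<bar> + 1) / norm A" by (intro divide_pos_pos) auto
      from C[OF this] have "\<bar>C\<bar> + 1 \<le> C" using True \<xi>_pos \<open>norm A \<noteq> 0\<close> by simp
      then show False by linarith
    qed
    then show ?thesis using True by simp
  next
    case False
    then have "r > 0" using r0 by simp
    have "q * norm A \<le> r * C" if q: "0 < q" "q < \<xi>" for q
      using C[of "q / r"] q \<open>r > 0\<close> by (simp add: field_simps)
    then have "\<forall>\<^sub>F q in at_left \<xi>. q * norm A \<le> r * C"
      using eventually_at_left_real[OF \<xi>_pos] by (auto elim: eventually_mono)
    moreover have "((\<lambda>q. q * norm A) \<longlongrightarrow> \<xi> * norm A) (at_left \<xi>)" by (intro tendsto_intros)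
    ultimately have "\<xi> * norm A \<le> r * C" by (intro tendsto_upperbound) auto
    then show ?thesis by (simp add: mult.commute)
  qed
  have "norm A * \<xi> \<le> r * weighted_norm G crit_val"
    using assms(8) by (intro bound key) (auto simp: crit_val_def)
  also have "\<dots> \<le> r * \<xi>" using weighted_norm_crit_val r0 by (rule mult_left_mono)
  finally have "norm A \<le> r" using \<xi>_pos by simp
  then have eq: "r = norm A" using r_le by simp
  moreover have "A = 0" if S: "?S < ereal (Re (f (of_real \<xi>)))"
  proof -
    have "0 \<le> ereal (norm (holomorphic_calculus f (1 *\<^sub>R A)))" by simp
    also have "\<dots> \<le> ?S" by (rule SUP_upper) simp
    finally obtain N where N: "?S = ereal N" "0 \<le> N"
      using S by (cases ?S) auto
    then have "N < crit_val" using S by (simp add: crit_val_def)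
    have "norm A * \<xi> \<le> r * weighted_norm G N"
      using N \<open>N < crit_val\<close> by (intro bound key) auto
    then have "norm A * (\<xi> - weighted_norm G N) \<le> 0" by (simp add: eq algebra_simps)
    then have "norm A = 0"
      using weighted_norm_less[OF N(2) \<open>N < crit_val\<close>] by (simp add: mult_le_0_iff)
    then show ?thesis by simp
  qed
  ultimately show ?thesis by (auto simp: quasi_nilpotent_def r_def)
qed

end
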